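(* Let $T$ be a complete first-order theory, let $\mathcal P=(J,\mathcal I,\mathcal C)$ be a maximal consistency pattern, and let $\mathsf P$ be the tree property defined via $\mathcal P$. Then $T$ has $\mathsf P$ if and only if $T$ has $\mathsf{SOP}_{\Sigma_{\mathcal P}}$.
   Context: Work in a monster model $\mathfrak U$ of $T$; variables are finite tuples. A consistency pattern is a triple $(J,\mathcal I,\mathcal C)$ where $J$ is a set, $\mathcal I$ is a family of $2$-element subsets of $J$ and $\mathcal C$ is a family of subsets of $J$, such that none of $J,\mathcal I,\mathcal C$ is empty, and there are no $I\in\mathcal I$, $C\in\mathcal C$ with $I\subseteq C$ or $C\subseteq I$. It is maximal iff: (M1) every $2$-element subset of $J$ not in $\mathcal I$ is contained in some $C\in\mathcal C$; (M2) for every $C\in\mathcal C$ and $j\in J\setminus C$ there is $i\in C$ with $\{i,j\}\in\mathcal I$; (M3) for every $j\in J$ there are at least two $i\in J$ with $\{i,j\}\in\mathcal I$. The tree property $\mathsf P$ defined via $\mathcal P$: a partitioned formula $\phi(x;y)$ has $\mathsf P$ iff there are $(b^j\mid j\in J)$ in $\mathfrak U^{|y|}$ such that for every $C\in\mathcal C$ the set $\{\phi(x;b^j)\mid j\in C\}$ is consistent and for every $I\in\mathcal I$ the set $\{\phi(x;b^j)\mid j\in I\}$ is inconsistent; $T$ has $\mathsf P$ iff some partitioned formula does. The poset $\Sigma_{\mathcal P}$ consists of pairwise distinct points $\beta_j,\gamma_j$ ($j\in J$) and $\alpha_C,\delta_C$ ($C\in\mathcal C$), ordered by the strict order $<$ that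 is the transitive closure of: $\alpha_C<\beta_i$ and $\gamma_i<\delta_C$ whenever $i\in C\in\mathcal C$; $\beta_i<\gamma_j$ and $\beta_j<\gamma_i$ whenever $\{i,j\}\in\mathcal I$ (with $\le$ meaning $<$ or $=$). For a class $\mathcal K$ of finite posets, a partitioned formula $\psi(x;y)$ has $\mathsf{SOP}_{\mathcal K}$ iff for every $(\sigma,\le)\in\mathcal K$ there are $(d^s\mid s\in\sigma)$ in $\mathfrak U^{|y|}$ with $\mathfrak U\models\forall x\,(\psi(x;d^{s_0})\rightarrow\psi(x;d^{s_1}))$ iff $\sigma\models s_0\le s_1$; $T$ has $\mathsf{SOP}_{\mathcal K}$ iff some partitioned formula does; for a poset $\Sigma$, $\mathsf{SOP}_\Sigma$ means $\mathsf{SOP}_{\mathrm{age}(\Sigma)}$, where $\mathrm{age}(\Sigma)$ is the class of finite posets embeddable in $\Sigma$. *)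

theory Defs
  imports Main "HOL-Library.FuncSet"
begin

unbundle cardinal_syntax

text \<open>
  First-order logic with equality. A symbol is identified by its name together with its arity, so
  a language is a set of function symbols and a set of relation symbols with arities. Formulas and
  structures are raw; membership in a language is imposed by the predicates below.
\<close>

datatype 'f tm = Var nat | Fn 'f "'f tm list"

datatype ('f, 'r) fm =
    Eq "'f tm" "'f tm"
  | Rel 'r "'f tm list"
  | Neg "('f, 'r) fm"
  | Conj "('f, 'r) fm" "('f, 'r) fm"
  | Exists nat "('f, 'r) fm"

record ('f, 'r) language =
  funs :: "('f \<times> nat) set"
  rels :: "('r \<times> nat) set"

record ('f, 'r, 'u) struct =
  univ :: "'u set"
  fint :: "'f \<Rightarrow> 'u list \<Rightarrow> 'u"
  rint :: "'r \<Rightarrow> 'u list \<Rightarrow> bool"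

fun wf_tm :: "('f, 'r) language \<Rightarrow> 'f tm \<Rightarrow> bool" where
  "wf_tm L (Var v) \<longleftrightarrow> True"
| "wf_tm L (Fn f ts) \<longleftrightarrow> (f, length ts) \<in> funs L \<and> (\<forall>t\<in>set ts. wf_tm L t)"

fun wf_fm :: "('f, 'r) language \<Rightarrow> ('f, 'r) fm \<Rightarrow> bool" where
  "wf_fm L (Eq t u) \<longleftrightarrow> wf_tm L t \<and> wf_tm L u"
| "wf_fm L (Rel r ts) \<longleftrightarrow> (r, length ts) \<in> rels L \<and> (\<forall>t\<in>set ts. wf_tm L t)"
| "wf_fm L (Neg \<phi>) \<longleftrightarrow> wf_fm L \<phi>"
| "wf_fm L (Conj \<phi> \<psi>) \<longleftrightarrow> wf_fm L \<phi> \<and> wf_fm L \<psi>"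
| "wf_fm L (Exists v \<phi>) \<longleftrightarrow> wf_fm L \<phi>"

fun fv_tm :: "'f tm \<Rightarrow> nat set" where
  "fv_tm (Var v) = {v}"
| "fv_tm (Fn f ts) = (\<Union>t\<in>set ts. fv_tm t)"

fun fv :: "('f, 'r) fm \<Rightarrow> nat set" where
  "fv (Eq t u) = fv_tm t \<union> fv_tm u"
| "fv (Rel r ts) = (\<Union>t\<in>set ts. fv_tm t)"
| "fv (Neg \<phi>) = fv \<phi>"
| "fv (Conj \<phi> \<psi>) = fv \<phi> \<union> fv \<psi>"
| "fv (Exists v \<phi>) = fv \<phi> - {v}"

fun eval_tm :: "('f, 'r, 'u) struct \<Rightarrow> (nat \<Rightarrow> 'u) \<Rightarrow> 'f tm \<Rightarrow> 'u" where
  "eval_tm M s (Var v) = s v"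
| "eval_tm M s (Fn f ts) = fint M f (map (eval_tm M s) ts)"

fun sat :: "('f, 'r, 'u) struct \<Rightarrow> (nat \<Rightarrow> 'u) \<Rightarrow> ('f, 'r) fm \<Rightarrow> bool" where
  "sat M s (Eq t u) \<longleftrightarrow> eval_tm M s t = eval_tm M s u"
| "sat M s (Rel r ts) \<longleftrightarrow> rint M r (map (eval_tm M s) ts)"
| "sat M s (Neg \<phi>) \<longleftrightarrow> \<not> sat M s \<phi>"
| "sat M s (Conj \<phi> \<psi>) \<longleftrightarrow> sat M s \<phi> \<and> sat M s \<psi>"
| "sat M s (Exists v \<phi>) \<longleftrightarrow> (\<exists>a\<in>univ M. sat M (s(v := a)) \<phi>)"

definition sentences :: "('f, 'r) language \<Rightarrow> ('f, 'r) fm set" where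
  "sentences L = {\<phi>. wf_fm L \<phi> \<and> fv \<phi> = {}}"

definition structure_of :: "('f, 'r) language \<Rightarrow> ('f, 'r, 'u) struct \<Rightarrow> bool" where
  "structure_of L M \<longleftrightarrow> univ M \<noteq> {} \<and>
     (\<forall>(f, n)\<in>funs L. \<forall>as\<in>lists (univ M). length as = n \<longrightarrow> fint M f as \<in> univ M)"

definition model_of ::
  "('f, 'r) language \<Rightarrow> ('f, 'r) fm set \<Rightarrow> ('f, 'r, 'u) struct \<Rightarrow> bool" where
  "model_of L T M \<longleftrightarrow> structure_of L M \<and> (\<forall>\<phi>\<in>T. \<forall>s. range s \<subseteq> univ M \<longrightarrow> sat M s \<phi>)"

text \<open>
  Satisfiability and semantic consequence range over the structures whose universe is a set of
  elements of the type of formulas. By the downward Loewenheim--Skolem theorem this is the same as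
  ranging over all structures: every structure has an elementary substructure of cardinality at
  most the number of formulas of the language.
\<close>

definition satisfiable :: "('f, 'r) language \<Rightarrow> ('f, 'r) fm set \<Rightarrow> bool" where
  "satisfiable L T \<longleftrightarrow> (\<exists>N :: ('f, 'r, ('f, 'r) fm) struct. model_of L T N)"

definition entails :: "('f, 'r) language \<Rightarrow> ('f, 'r) fm set \<Rightarrow> ('f, 'r) fm \<Rightarrow> bool" where
  "entails L T \<phi> \<longleftrightarrow>
     (\<forall>N :: ('f, 'r, ('f, 'r) fm) struct. model_of L T N \<longrightarrow> model_of L {\<phi>} N)"

definition complete_theory :: "('f, 'r) language \<Rightarrow> ('f, 'r) fm set \<Rightarrow> bool" where
  "complete_theory L T \<longleftrightarrow> T \<subseteq> sentences L \<and> satisfiable L T \<and>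
     (\<forall>\<phi>\<in>sentences L. entails L T \<phi> \<or> entails L T (Neg \<phi>))"

text \<open>
  A tuple of variables is a finite set \<open>X\<close> of variables, and a tuple of elements indexed by it is
  an assignment whose values on \<open>X\<close> lie in the universe. A formula with parameters in the
  variables \<open>X\<close> is a pair \<open>(\<phi>, b)\<close>: the free variables of \<open>\<phi>\<close> outside \<open>X\<close> are read as the
  parameters that \<open>b\<close> assigns to them. A set of formulas with parameters from \<open>M\<close> is consistent
  (with the elementary diagram of \<open>M\<close>) if it is finitely satisfiable in \<open>M\<close>.
\<close>

definition realizes ::
  "('f, 'r, 'u) struct \<Rightarrow> nat set \<Rightarrow> (nat \<Rightarrow> 'u) \<Rightarrow> (('f, 'r) fm \<times> (nat \<Rightarrow> 'u)) set \<Rightarrow> bool" where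
  "realizes M X a p \<longleftrightarrow> (\<forall>(\<phi>, b)\<in>p. sat M (override_on b a X) \<phi>)"

definition consistent ::
  "('f, 'r, 'u) struct \<Rightarrow> nat set \<Rightarrow> (('f, 'r) fm \<times> (nat \<Rightarrow> 'u)) set \<Rightarrow> bool" where
  "consistent M X p \<longleftrightarrow>
     (\<forall>q. q \<subseteq> p \<and> finite q \<longrightarrow> (\<exists>a \<in> X \<rightarrow> univ M. realizes M X a q))"

definition formulas_over ::
  "('f, 'r) language \<Rightarrow> nat set \<Rightarrow> 'u set \<Rightarrow> (('f, 'r) fm \<times> (nat \<Rightarrow> 'u)) set" where
  "formulas_over L X A = {(\<phi>, b). wf_fm L \<phi> \<and> b ` (fv \<phi> - X) \<subseteq> A}"

definition saturated :: "('f, 'r) language \<Rightarrow> 'k rel \<Rightarrow> ('f, 'r, 'u) struct \<Rightarrow> bool" where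
  "saturated L \<kappa> M \<longleftrightarrow>
     (\<forall>A p v. A \<subseteq> univ M \<and> |A| <o \<kappa> \<and> p \<subseteq> formulas_over L {v} A \<and> consistent M {v} p
        \<longrightarrow> (\<exists>a \<in> {v} \<rightarrow> univ M. realizes M {v} a p))"

definition elementary_map ::
  "('f, 'r) language \<Rightarrow> ('f, 'r, 'u) struct \<Rightarrow> 'u set \<Rightarrow> ('u \<Rightarrow> 'u) \<Rightarrow> bool" where
  "elementary_map L M A h \<longleftrightarrow> h \<in> A \<rightarrow> univ M \<and>
     (\<forall>\<phi> s. wf_fm L \<phi> \<and> s ` fv \<phi> \<subseteq> A \<longrightarrow> (sat M s \<phi> \<longleftrightarrow> sat M (h \<circ> s) \<phi>))"

definition automorphism ::
  "('f, 'r) language \<Rightarrow> ('f, 'r, 'u) struct \<Rightarrow> ('u \<Rightarrow> 'u) \<Rightarrow> bool" where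
  "automorphism L M h \<longleftrightarrow> bij_betw h (univ M) (univ M) \<and>
     (\<forall>as\<in>lists (univ M).
        (\<forall>f. (f, length as) \<in> funs L \<longrightarrow> h (fint M f as) = fint M f (map h as)) \<and>
        (\<forall>r. (r, length as) \<in> rels L \<longrightarrow> (rint M r as \<longleftrightarrow> rint M r (map h as))))"

definition strongly_homogeneous ::
  "('f, 'r) language \<Rightarrow> 'k rel \<Rightarrow> ('f, 'r, 'u) struct \<Rightarrow> bool" where
  "strongly_homogeneous L \<kappa> M \<longleftrightarrow>
     (\<forall>A h. A \<subseteq> univ M \<and> |A| <o \<kappa> \<and> elementary_map L M A h
        \<longrightarrow> (\<exists>g. automorphism L M g \<and> (\<forall>a\<in>A. g a = h a)))"

text \<open>
  The cardinal \<open>\<kappa>\<close> bounds what counts as small. The universe is required to be infinite, i.e.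
  \<open>T\<close> has infinite models; saturation then makes it at least as large as \<open>\<kappa>\<close>.
\<close>

definition monster_model ::
  "('f, 'r) language \<Rightarrow> ('f, 'r) fm set \<Rightarrow> 'k rel \<Rightarrow> ('f, 'r, 'u) struct \<Rightarrow> bool" where
  "monster_model L T \<kappa> M \<longleftrightarrow>
     Card_order \<kappa> \<and> |{\<phi>. wf_fm L \<phi>}| <o \<kappa> \<and> model_of L T M \<and> infinite (univ M) \<and>
     saturated L \<kappa> M \<and> strongly_homogeneous L \<kappa> M"

definition partitioned_formula ::
  "('f, 'r) language \<Rightarrow> ('f, 'r) fm \<Rightarrow> nat set \<Rightarrow> nat set \<Rightarrow> bool" where
  "partitioned_formula L \<phi> X Y \<longleftrightarrow>
     wf_fm L \<phi> \<and> finite X \<and> finite Y \<and> X \<inter> Y = {} \<and> fv \<phi> \<subseteq> X \<union> Y"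

definition consistency_pattern :: "'j set \<Rightarrow> 'j set set \<Rightarrow> 'j set set \<Rightarrow> bool" where
  "consistency_pattern J \<I> \<C> \<longleftrightarrow>
     (\<forall>I\<in>\<I>. I \<subseteq> J \<and> card I = 2) \<and> (\<forall>C\<in>\<C>. C \<subseteq> J) \<and>
     J \<noteq> {} \<and> \<I> \<noteq> {} \<and> \<C> \<noteq> {} \<and>
     \<not> (\<exists>I\<in>\<I>. \<exists>C\<in>\<C>. I \<subseteq> C \<or> C \<subseteq> I)"

definition maximal_consistency_pattern :: "'j set \<Rightarrow> 'j set set \<Rightarrow> 'j set set \<Rightarrow> bool" where
  "maximal_consistency_pattern J \<I> \<C> \<longleftrightarrow> consistency_pattern J \<I> \<C> \<and>
     (\<forall>D. D \<subseteq> J \<and> card D = 2 \<and> D \<notin> \<I> \<longrightarrow> (\<exists>C\<in>\<C>. D \<subseteq> C)) \<and>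
     (\<forall>C\<in>\<C>. \<forall>j\<in>J - C. \<exists>i\<in>C. {i, j} \<in> \<I>) \<and>
     (\<forall>j\<in>J. \<exists>i\<in>J. \<exists>i'\<in>J. i \<noteq> i' \<and> {i, j} \<in> \<I> \<and> {i', j} \<in> \<I>)"

definition formula_has_tree_property ::
  "('f, 'r, 'u) struct \<Rightarrow> 'j set \<Rightarrow> 'j set set \<Rightarrow> 'j set set \<Rightarrow>
   ('f, 'r) fm \<Rightarrow> nat set \<Rightarrow> nat set \<Rightarrow> bool" where
  "formula_has_tree_property M J \<I> \<C> \<phi> X Y \<longleftrightarrow>
     (\<exists>b :: 'j \<Rightarrow> nat \<Rightarrow> 'u. (\<forall>j\<in>J. b j \<in> Y \<rightarrow> univ M) \<and>
        (\<forall>C\<in>\<C>. consistent M X {(\<phi>, b j) | j. j \<in> C}) \<and>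
        (\<forall>I\<in>\<I>. \<not> consistent M X {(\<phi>, b j) | j. j \<in> I}))"

definition has_tree_property ::
  "('f, 'r) language \<Rightarrow> ('f, 'r, 'u) struct \<Rightarrow> 'j set \<Rightarrow> 'j set set \<Rightarrow> 'j set set \<Rightarrow> bool" where
  "has_tree_property L M J \<I> \<C> \<longleftrightarrow>
     (\<exists>\<phi> X Y. partitioned_formula L \<phi> X Y \<and> formula_has_tree_property M J \<I> \<C> \<phi> X Y)"

text \<open>Posets are pairs of a carrier and its (reflexive) order relation.\<close>

definition formula_has_SOP ::
  "('f, 'r, 'u) struct \<Rightarrow> ('s set \<times> 's rel) set \<Rightarrow> ('f, 'r) fm \<Rightarrow> nat set \<Rightarrow> nat set \<Rightarrow> bool" where
  "formula_has_SOP M K \<psi> X Y \<longleftrightarrow>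
     (\<forall>(S, R)\<in>K. \<exists>d :: 's \<Rightarrow> nat \<Rightarrow> 'u. (\<forall>s\<in>S. d s \<in> Y \<rightarrow> univ M) \<and>
        (\<forall>s\<in>S. \<forall>t\<in>S.
           (\<forall>a \<in> X \<rightarrow> univ M. sat M (override_on (d s) a X) \<psi> \<longrightarrow> sat M (override_on (d t) a X) \<psi>)
           \<longleftrightarrow> (s, t) \<in> R))"

definition has_SOP ::
  "('f, 'r) language \<Rightarrow> ('f, 'r, 'u) struct \<Rightarrow> ('s set \<times> 's rel) set \<Rightarrow> bool" where
  "has_SOP L M K \<longleftrightarrow>
     (\<exists>\<psi> X Y. partitioned_formula L \<psi> X Y \<and> formula_has_SOP M K \<psi> X Y)"

text \<open>Every finite poset is isomorphic to one whose points are natural numbers.\<close>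

definition age :: "'p set \<times> 'p rel \<Rightarrow> (nat set \<times> nat rel) set" where
  "age P = {(S, R). finite S \<and> partial_order_on S R \<and>
     (\<exists>e \<in> S \<rightarrow> fst P. inj_on e S \<and> (\<forall>s\<in>S. \<forall>t\<in>S. (s, t) \<in> R \<longleftrightarrow> (e s, e t) \<in> snd P))}"

datatype 'j point = \<alpha> "'j set" | \<beta> 'j | \<gamma> 'j | \<delta> "'j set"

definition \<Sigma>_carrier :: "'j set \<Rightarrow> 'j set set \<Rightarrow> 'j point set" where
  "\<Sigma>_carrier J \<C> = \<alpha> ` \<C> \<union> \<beta> ` J \<union> \<gamma> ` J \<union> \<delta> ` \<C>"

definition \<Sigma>_less :: "'j set set \<Rightarrow> 'j set set \<Rightarrow> 'j point rel" where
  "\<Sigma>_less \<I> \<C> =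
     ({(\<alpha> C, \<beta> i) | C i. C \<in> \<C> \<and> i \<in> C} \<union>
      {(\<gamma> i, \<delta> C) | C i. C \<in> \<C> \<and> i \<in> C} \<union>
      {(\<beta> i, \<gamma> j) | i j. {i, j} \<in> \<I>})\<^sup>+"

definition \<Sigma>_poset :: "'j set \<Rightarrow> 'j set set \<Rightarrow> 'j set set \<Rightarrow> 'j point set \<times> 'j point rel" where
  "\<Sigma>_poset J \<I> \<C> = (\<Sigma>_carrier J \<C>, \<Sigma>_less \<I> \<C> \<union> Id_on (\<Sigma>_carrier J \<C>))"

end

theory Submission
  imports Defs "HOL-Library.Countable"
begin

text \<open>
  If \<open>\<psi>(x; y)\<close> has SOP, let \<open>\<phi>(u; y\<^sub>1, y\<^sub>2)\<close> say that \<open>\<psi>(x; u)\<close> implies \<open>\<psi>(x; y\<^sub>1)\<close> but not \<open>\<psi>(x; y\<^sub>2)\<close>,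
  and let the parameter at \<open>j\<close> be the pair of those at \<open>\<beta> j\<close> and \<open>\<gamma> j\<close>. The parameter at \<open>\<alpha> C\<close>
  realises the instances with \<open>j \<in> C\<close>, while \<open>\<beta> i < \<gamma> j\<close> makes the instances at \<open>i\<close> and \<open>j\<close>
  contradictory. SOP only speaks about finite subposets, so saturation is needed to find the
  parameters for all \<open>j \<in> J\<close> at once.

  Conversely, given \<open>\<phi>(x; b\<^sup>j)\<close>, let \<open>\<beta> j\<close> be the solution set of \<open>\<phi>(x; b\<^sup>j)\<close> enlarged by points
  belonging to \<open>j\<close> alone, \<open>\<alpha> C\<close> the set given by a point realising exactly the instances with
  \<open>j \<in> C\<close>, and \<open>\<gamma> j\<close> and \<open>\<delta> C\<close> the complements of \<open>\<beta> j\<close> and \<open>\<alpha> C\<close>. Maximality gives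
  \<open>\<alpha> C < \<gamma> j \<longleftrightarrow> j \<notin> C\<close>, \<open>\<beta> j < \<delta> C \<longleftrightarrow> j \<notin> C\<close> and \<open>\<alpha> C < \<delta> D \<longleftrightarrow> C \<noteq> D\<close>, which is inclusion
  of these sets.
\<close>

section \<open>Renaming variables\<close>

lemma eval_tm_cong:
  "(\<And>v. v \<in> fv_tm t \<Longrightarrow> s v = s' v) \<Longrightarrow> eval_tm M s t = eval_tm M s' t"
proof (induction t)
  case (Fn f ts)
  then have "map (eval_tm M s) ts = map (eval_tm M s') ts"
    by fastforce
  then show ?case by (metis eval_tm.simps(2))
qed simp

lemma sat_cong:
  "(\<And>v. v \<in> fv \<phi> \<Longrightarrow> s v = s' v) \<Longrightarrow> sat M s \<phi> \<longleftrightarrow> sat M s' \<phi>"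
proof (induction \<phi> arbitrary: s s')
  case (Eq t u)
  then show ?case using eval_tm_cong[of t s s' M] eval_tm_cong[of u s s' M] by auto
next
  case (Rel r ts)
  then have "map (eval_tm M s) ts = map (eval_tm M s') ts"
    by (auto intro: eval_tm_cong)
  then show ?case by (metis sat.simps(2))
next
  case (Conj \<phi> \<psi>)
  have "sat M s \<phi> \<longleftrightarrow> sat M s' \<phi>" "sat M s \<psi> \<longleftrightarrow> sat M s' \<psi>"
    using Conj.prems by (auto intro!: Conj.IH)
  then show ?case by simp
next
  case (Exists v \<phi>)
  have "sat M (s(v := a)) \<phi> \<longleftrightarrow> sat M (s'(v := a)) \<phi>" for a
    using Exists.prems by (intro Exists.IH) auto
  then show ?case by simp
next
  case (Neg \<phi>)
  have "sat M s \<phi> \<longleftrightarrow> sat M s' \<phi>"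
    using Neg.prems by (intro Neg.IH) auto
  then show ?case by simp
qed

lemma finite_fv_tm: "finite (fv_tm t)"
  by (induction t) auto

lemma finite_fv: "finite (fv \<phi>)"
  by (induction \<phi>) (auto simp: finite_fv_tm)

primrec rename_tm :: "(nat \<Rightarrow> nat) \<Rightarrow> 'f tm \<Rightarrow> 'f tm" where
  "rename_tm \<rho> (Var v) = Var (\<rho> v)"
| "rename_tm \<rho> (Fn f ts) = Fn f (map (rename_tm \<rho>) ts)"

lemma wf_rename_tm: "wf_tm L t \<Longrightarrow> wf_tm L (rename_tm \<rho> t)"
  by (induction t) auto

lemma fv_rename_tm: "fv_tm (rename_tm \<rho> t) = \<rho> ` fv_tm t"
  by (induction t) auto

lemma eval_rename_tm: "eval_tm M s (rename_tm \<rho> t) = eval_tm M (s \<circ> \<rho>) t"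
  by (induction t) (auto intro!: arg_cong[where f = "fint M _"])

text \<open>\<open>\<rho>\<close> need not be injective, so bound variables may have to be changed
  to avoid capture. Only the existence of a renamed formula matters later, hence no renaming
  function on formulas is fixed.\<close>

lemma rename_fm_exists:
  fixes M :: "('f, 'r, 'u) struct" and \<phi> :: "('f, 'r) fm"
  assumes "wf_fm L \<phi>"
  shows "\<exists>\<phi>'. wf_fm L \<phi>' \<and> fv \<phi>' = \<rho> ` fv \<phi> \<and> (\<forall>s. sat M s \<phi>' \<longleftrightarrow> sat M (s \<circ> \<rho>) \<phi>)"
  using assms
proof (induction \<phi> arbitrary: \<rho>)
  case (Eq t u)
  then show ?case
    by (intro exI[of _ "Eq (rename_tm \<rho> t) (rename_tm \<rho> u)"])
      (auto simp: wf_rename_tm fv_rename_tm eval_rename_tm simp del: comp_apply)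
next
  case (Rel r ts)
  have "map (eval_tm M s) (map (rename_tm \<rho>) ts) = map (eval_tm M (s \<circ> \<rho>)) ts" for s
    by (simp add: eval_rename_tm)
  with Rel show ?case
    by (intro exI[of _ "Rel r (map (rename_tm \<rho>) ts)"])
      (auto simp: wf_rename_tm fv_rename_tm simp del: map_map comp_apply)
next
  case (Neg \<phi>)
  then have "wf_fm L \<phi>" by simp
  then obtain \<phi>' where "wf_fm L \<phi>'" "fv \<phi>' = \<rho> ` fv \<phi>" "\<forall>s. sat M s \<phi>' \<longleftrightarrow> sat M (s \<circ> \<rho>) \<phi>"
    using Neg.IH by blast
  then show ?case by (intro exI[of _ "Neg \<phi>'"]) (simp add: o_def)
next
  case (Conj \<phi> \<psi>)
  have wf: "wf_fm L \<phi>" "wf_fm L \<psi>"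
    using Conj.prems by simp_all
  obtain \<phi>' where
    "wf_fm L \<phi>'" "fv \<phi>' = \<rho> ` fv \<phi>" "\<forall>s. sat M s \<phi>' \<longleftrightarrow> sat M (s \<circ> \<rho>) \<phi>"
    using Conj.IH(1)[OF wf(1), of \<rho>] by blast
  moreover obtain \<psi>' where
    "wf_fm L \<psi>'" "fv \<psi>' = \<rho> ` fv \<psi>" "\<forall>s. sat M s \<psi>' \<longleftrightarrow> sat M (s \<circ> \<rho>) \<psi>"
    using Conj.IH(2)[OF wf(2), of \<rho>] by blast
  ultimately show ?case by (intro exI[of _ "Conj \<phi>' \<psi>'"]) (simp add: image_Un o_def)
next
  case (Exists v \<phi>)
  have "wf_fm L \<phi>" using Exists.prems by simp
  \<comment> \<open>As \<open>w\<close> differs from the image of every free variable of the body,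
    binding \<open>w\<close> captures nothing.\<close>
  obtain w where w: "w \<notin> \<rho> ` fv \<phi>"
    using ex_new_if_finite[OF infinite_UNIV_nat finite_imageI[OF finite_fv]] by metis
  obtain \<phi>' where \<phi>': "wf_fm L \<phi>'" "fv \<phi>' = \<rho>(v := w) ` fv \<phi>"
    "\<And>s. sat M s \<phi>' \<longleftrightarrow> sat M (s \<circ> \<rho>(v := w)) \<phi>"
    using Exists.IH[OF \<open>wf_fm L \<phi>\<close>, of "\<rho>(v := w)"] by blast
  have "sat M (s(w := a)) \<phi>' \<longleftrightarrow> sat M ((s \<circ> \<rho>)(v := a)) \<phi>" for s a
    unfolding \<phi>'(3) using w by (intro sat_cong) auto
  moreover have "fv (Exists w \<phi>') = \<rho> ` fv (Exists v \<phi>)"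
    using w \<phi>'(2) by auto
  ultimately show ?case
    using \<phi>'(1) by (intro exI[of _ "Exists w \<phi>'"]) (simp add: o_def del: fv.simps)
qed

section \<open>Definable predicates\<close>

text \<open>Predicates on assignments of variables from an arbitrary type; this allows types in infinitely
  many variables and makes fresh variables available as summands. The map \<open>\<rho>\<close> names the object
  variables of the defining formula.\<close>

definition definable ::
  "('f, 'r) language \<Rightarrow> ('f, 'r, 'u) struct \<Rightarrow> 'v set \<Rightarrow> (('v \<Rightarrow> 'u) \<Rightarrow> bool) \<Rightarrow> bool" where
  "definable L M V Q \<longleftrightarrow>
     (\<exists>\<phi> \<rho>. wf_fm L \<phi> \<and> \<rho> ` fv \<phi> \<subseteq> V \<and> (\<forall>s. Q s \<longleftrightarrow> sat M (s \<circ> \<rho>) \<phi>))"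

lemma definableI:
  "wf_fm L \<phi> \<Longrightarrow> \<rho> ` fv \<phi> \<subseteq> V \<Longrightarrow> (\<And>s. Q s \<longleftrightarrow> sat M (s \<circ> \<rho>) \<phi>) \<Longrightarrow> definable L M V Q"
  unfolding definable_def by (intro exI[of _ \<phi>] exI[of _ \<rho>]) simp

lemma definable_sat: "wf_fm L \<phi> \<Longrightarrow> \<rho> ` fv \<phi> \<subseteq> V \<Longrightarrow> definable L M V (\<lambda>s. sat M (s \<circ> \<rho>) \<phi>)"
  by (rule definableI) auto

lemma definable_mono: "definable L M V Q \<Longrightarrow> V \<subseteq> W \<Longrightarrow> definable L M W Q"
  unfolding definable_def by (meson order_trans)

lemma definable_support:
  assumes "definable L M V Q"
  obtains W where "finite W" "W \<subseteq> V" "definable L M W Q"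
proof -
  obtain \<phi> \<rho> where "wf_fm L \<phi>" "\<rho> ` fv \<phi> \<subseteq> V" "\<forall>s. Q s \<longleftrightarrow> sat M (s \<circ> \<rho>) \<phi>"
    using assms unfolding definable_def by blast
  then show thesis
    by (intro that[of "\<rho> ` fv \<phi>"] definableI[of _ \<phi> \<rho>] finite_imageI finite_fv) auto
qed

lemma definable_agree:
  assumes "definable L M V Q" and "\<And>v. v \<in> V \<Longrightarrow> s v = t v"
  shows "Q s \<longleftrightarrow> Q t"
proof -
  obtain \<phi> \<rho> where "\<rho> ` fv \<phi> \<subseteq> V" and Q: "\<forall>s. Q s \<longleftrightarrow> sat M (s \<circ> \<rho>) \<phi>"
    using assms(1) unfolding definable_def by blast
  then have "sat M (s \<circ> \<rho>) \<phi> \<longleftrightarrow> sat M (t \<circ> \<rho>) \<phi>"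
    using assms(2) by (intro sat_cong) auto
  then show ?thesis using Q by simp
qed

lemma definable_subst:
  assumes "definable L M V Q"
  shows "definable L M (g ` V) (\<lambda>s. Q (s \<circ> g))"
proof -
  obtain \<phi> \<rho> where "wf_fm L \<phi>" "\<rho> ` fv \<phi> \<subseteq> V" "\<forall>s. Q s \<longleftrightarrow> sat M (s \<circ> \<rho>) \<phi>"
    using assms unfolding definable_def by blast
  then show ?thesis
    by (intro definableI[of _ \<phi> "g \<circ> \<rho>"]) (auto simp: comp_assoc)
qed

text \<open>Under an arbitrary naming several object variables may stand for \<open>v\<close>, and
  binding one of them would not quantify over \<open>v\<close>. The map \<open>r\<close> collects
  them at 0 and shifts the others out of the way; then one quantifier, or a 1-type in variable 0,
  speaks about \<open>v\<close>.\<close>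

lemma definable_isolate:
  assumes "definable L M V Q"
  obtains \<phi> \<rho> where "wf_fm L \<phi>" "\<rho> ` fv \<phi> \<subseteq> V" "\<And>n. n \<in> fv \<phi> \<Longrightarrow> \<rho> n = v \<longleftrightarrow> n = 0"
    "\<rho> 0 = v" "\<And>s. Q s \<longleftrightarrow> sat M (s \<circ> \<rho>) \<phi>"
proof -
  obtain \<phi> \<rho> where \<phi>: "wf_fm L \<phi>" "\<rho> ` fv \<phi> \<subseteq> V" "\<And>s. Q s \<longleftrightarrow> sat M (s \<circ> \<rho>) \<phi>"
    using assms unfolding definable_def by blast
  define r where "r n = (if \<rho> n = v then 0 else Suc n)" for n
  define \<rho>' where "\<rho>' n = (case n of 0 \<Rightarrow> v | Suc m \<Rightarrow> \<rho> m)" for n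
  have r: "\<rho>' \<circ> r = \<rho>"
    by (auto simp: r_def \<rho>'_def)
  obtain \<phi>' where \<phi>': "wf_fm L \<phi>'" "fv \<phi>' = r ` fv \<phi>" "\<And>s. sat M s \<phi>' \<longleftrightarrow> sat M (s \<circ> r) \<phi>"
    using rename_fm_exists[OF \<phi>(1)] by blast
  show thesis
  proof (rule that[of \<phi>' \<rho>'])
    show "\<rho>' ` fv \<phi>' \<subseteq> V"
      using \<phi>(2) by (simp add: \<phi>'(2) image_comp r)
    show "Q s \<longleftrightarrow> sat M (s \<circ> \<rho>') \<phi>'" for s
      by (simp add: \<phi>'(3) \<phi>(3) comp_assoc r)
    show "\<rho>' n = v \<longleftrightarrow> n = 0" if "n \<in> fv \<phi>'" for n
      using that by (auto simp: \<phi>'(2) \<rho>'_def r_def)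
  qed (auto simp: \<phi>'(1) \<rho>'_def)
qed

lemma definable_not:
  assumes "definable L M V Q"
  shows "definable L M V (\<lambda>s. \<not> Q s)"
proof -
  obtain \<phi> \<rho> where "wf_fm L \<phi>" "\<rho> ` fv \<phi> \<subseteq> V" "\<forall>s. Q s \<longleftrightarrow> sat M (s \<circ> \<rho>) \<phi>"
    using assms unfolding definable_def by blast
  then show ?thesis
    by (intro definableI[of _ "Neg \<phi>" \<rho>]) auto
qed

lemma definable_True: "definable L M V (\<lambda>_. True)"
  \<comment> \<open>The tautology is closed, so that \<open>V\<close> may be empty.\<close>
  by (rule definableI[of _ "Neg (Exists 0 (Neg (Eq (Var 0) (Var 0))))"]) auto

lemma definable_eq: "v \<in> V \<Longrightarrow> w \<in> V \<Longrightarrow> definable L M V (\<lambda>s. s v = s w)"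
  by (rule definableI[of _ "Eq (Var 0) (Var 1)" "\<lambda>n. if n = 0 then v else w"]) auto

lemma definable_conj:
  assumes "definable L M V P" and "definable L M V Q"
  shows "definable L M V (\<lambda>s. P s \<and> Q s)"
proof -
  obtain \<phi> \<rho> where \<phi>: "wf_fm L \<phi>" "\<rho> ` fv \<phi> \<subseteq> V" "\<And>s. P s \<longleftrightarrow> sat M (s \<circ> \<rho>) \<phi>"
    using assms(1) unfolding definable_def by blast
  obtain \<psi> \<sigma> where \<psi>: "wf_fm L \<psi>" "\<sigma> ` fv \<psi> \<subseteq> V" "\<And>s. Q s \<longleftrightarrow> sat M (s \<circ> \<sigma>) \<psi>"
    using assms(2) unfolding definable_def by blast
  \<comment> \<open>The two formulas may use the same object variable for different elements of
    \<open>V\<close>. Moving one to even and the other to odd numbers lets a single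
    \<open>\<tau>\<close> name both.\<close>
  define \<tau> where "\<tau> n = (if even n then \<rho> (n div 2) else \<sigma> (n div 2))" for n :: nat
  have \<tau>: "\<tau> \<circ> (\<lambda>n. 2 * n) = \<rho>" "\<tau> \<circ> (\<lambda>n. Suc (2 * n)) = \<sigma>"
    by (auto simp: \<tau>_def)
  obtain \<phi>' where \<phi>': "wf_fm L \<phi>'" "fv \<phi>' = (\<lambda>n. 2 * n) ` fv \<phi>"
    "\<And>s. sat M s \<phi>' \<longleftrightarrow> sat M (s \<circ> (\<lambda>n. 2 * n)) \<phi>"
    using rename_fm_exists[OF \<phi>(1)] by blast
  obtain \<psi>' where \<psi>': "wf_fm L \<psi>'" "fv \<psi>' = (\<lambda>n. Suc (2 * n)) ` fv \<psi>"
    "\<And>s. sat M s \<psi>' \<longleftrightarrow> sat M (s \<circ> (\<lambda>n. Suc (2 * n))) \<psi>"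
    using rename_fm_exists[OF \<psi>(1)] by blast
  show ?thesis
  proof (rule definableI[of _ "Conj \<phi>' \<psi>'" \<tau>])
    show "\<tau> ` fv (Conj \<phi>' \<psi>') \<subseteq> V"
      using \<phi>(2) \<psi>(2) by (simp add: \<phi>'(2) \<psi>'(2) image_Un image_comp \<tau>)
    show "P s \<and> Q s \<longleftrightarrow> sat M (s \<circ> \<tau>) (Conj \<phi>' \<psi>')" for s
      by (simp add: \<phi>'(3) \<psi>'(3) \<phi>(3) \<psi>(3) comp_assoc \<tau>)
  qed (simp add: \<phi>'(1) \<psi>'(1))
qed

lemma definable_disj:
  assumes "definable L M V P" and "definable L M V Q"
  shows "definable L M V (\<lambda>s. P s \<or> Q s)"
  using definable_not[OF definable_conj[OF assms[THEN definable_not]]] by simp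

lemma definable_if:
  assumes "definable L M V P" "definable L M V Q" "definable L M V R"
  shows "definable L M V (\<lambda>s. if P s then Q s else R s)"
proof -
  have "definable L M V (\<lambda>s. (P s \<and> Q s) \<or> (\<not> P s \<and> R s))"
    by (intro definable_disj definable_conj definable_not assms)
  then show ?thesis
    by (rule back_subst[of "definable L M V"]) auto
qed

lemma definable_iff:
  assumes "definable L M V P" "definable L M V Q"
  shows "definable L M V (\<lambda>s. P s \<longleftrightarrow> Q s)"
  using definable_if[OF assms(1,2) definable_not[OF assms(2)]]
  by (rule back_subst[of "definable L M V"]) auto

lemma definable_ball:
  assumes "finite F" and "\<And>i. i \<in> F \<Longrightarrow> definable L M V (Q i)"
  shows "definable L M V (\<lambda>s. \<forall>i\<in>F. Q i s)"
  using assms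
proof (induction F rule: finite_induct)
  case empty
  then show ?case by (simp add: definable_True)
next
  case (insert i F)
  then show ?case using definable_conj[of L M V "Q i" "\<lambda>s. \<forall>i\<in>F. Q i s"] by simp
qed

lemma definable_ex:
  assumes "definable L M V Q"
  shows "definable L M (V - {v}) (\<lambda>s. \<exists>a\<in>univ M. Q (s(v := a)))"
proof -
  obtain \<phi> \<rho> where \<phi>: "wf_fm L \<phi>" "\<rho> ` fv \<phi> \<subseteq> V" "\<And>n. n \<in> fv \<phi> \<Longrightarrow> \<rho> n = v \<longleftrightarrow> n = 0"
    "\<rho> 0 = v" "\<And>s. Q s \<longleftrightarrow> sat M (s \<circ> \<rho>) \<phi>"
    using definable_isolate[OF assms] by metis
  have "sat M (s(v := a) \<circ> \<rho>) \<phi> \<longleftrightarrow> sat M ((s \<circ> \<rho>)(0 := a)) \<phi>" for s a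
    using \<phi>(3) by (intro sat_cong) auto
  then show ?thesis
    using \<phi> by (intro definableI[of _ "Exists 0 \<phi>" \<rho>]) auto
qed

lemma definable_ex_set:
  assumes "finite W" and "definable L M V Q"
  shows "definable L M (V - W) (\<lambda>s. \<exists>a\<in>W \<rightarrow> univ M. Q (override_on s a W))"
  using assms
proof (induction W rule: finite_induct)
  case empty
  then show ?case by simp
next
  case (insert v W)
  have "(\<exists>b\<in>univ M. \<exists>a\<in>W \<rightarrow> univ M. Q (override_on (s(v := b)) a W)) \<longleftrightarrow>
    (\<exists>a\<in>insert v W \<rightarrow> univ M. Q (override_on s a (insert v W)))" (is "?l \<longleftrightarrow> ?r") for s
  proof
    assume ?l
    then obtain b a where ab: "b \<in> univ M" "a \<in> W \<rightarrow> univ M" "Q (override_on (s(v := b)) a W)"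
      by blast
    moreover have "override_on (s(v := b)) a W = override_on s (a(v := b)) (insert v W)"
      using insert.hyps by (auto simp: override_on_def)
    ultimately show ?r
      by (intro bexI[of _ "a(v := b)"]) auto
  next
    assume ?r
    then obtain a where a: "a \<in> insert v W \<rightarrow> univ M" "Q (override_on s a (insert v W))"
      by blast
    moreover have "override_on (s(v := a v)) a W = override_on s a (insert v W)"
      by (auto simp: override_on_def)
    ultimately show ?l
      by (intro bexI[of _ "a v"] bexI[of _ a]) auto
  qed
  moreover have "definable L M (V - W - {v})
    (\<lambda>s. \<exists>b\<in>univ M. \<exists>a\<in>W \<rightarrow> univ M. Q (override_on (s(v := b)) a W))"
    using definable_ex[OF insert.IH[OF insert.prems]] .
  moreover have "V - W - {v} = V - insert v W" by auto
  ultimately show ?case by simp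
qed

lemma definable_ex_tuple:
  assumes "finite X" and "definable L M (Inl ` X \<union> Inr ` V) Q"
  shows "definable L M V (\<lambda>s. \<exists>a\<in>X \<rightarrow> univ M. Q (case_sum a s))"
proof -
  \<comment> \<open>\<open>?g\<close> forgets the left summand. The value at
    \<open>undefined\<close> that it puts there is harmless: the variables of \<open>X\<close> are
    overwritten, and \<open>Q\<close> looks at no others on the left.\<close>
  let ?g = "case_sum (\<lambda>_. undefined) id"
  let ?P = "\<lambda>s. \<exists>a\<in>Inl ` X \<rightarrow> univ M. Q (override_on s a (Inl ` X))"
  have V: "?g ` (Inl ` X \<union> Inr ` V - Inl ` X) = V"
    by (force simp: image_iff)
  have "definable L M V (\<lambda>s. ?P (s \<circ> ?g))"
    using definable_subst[OF definable_ex_set[OF finite_imageI[OF assms(1), of Inl] assms(2)], of ?g]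
    unfolding V .
  moreover have "?P (s \<circ> ?g) \<longleftrightarrow> (\<exists>a\<in>X \<rightarrow> univ M. Q (case_sum a s))" (is "?l \<longleftrightarrow> ?r") for s
  proof
    assume ?l
    then obtain a where a: "a \<in> Inl ` X \<rightarrow> univ M" "Q (override_on (s \<circ> ?g) a (Inl ` X))"
      by blast
    have "Q (override_on (s \<circ> ?g) a (Inl ` X)) \<longleftrightarrow> Q (case_sum (a \<circ> Inl) s)"
      by (rule definable_agree[OF assms(2)]) (auto simp: override_on_def)
    with a show ?r by (intro bexI[of _ "a \<circ> Inl"]) auto
  next
    assume ?r
    then obtain a where a: "a \<in> X \<rightarrow> univ M" "Q (case_sum a s)"
      by blast
    have "Q (override_on (s \<circ> ?g) (case_sum a s) (Inl ` X)) \<longleftrightarrow> Q (case_sum a s)"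
      by (rule definable_agree[OF assms(2)]) (auto simp: override_on_def)
    with a show ?l by (intro bexI[of _ "case_sum a s"]) auto
  qed
  ultimately show ?thesis by simp
qed

text \<open>The way back to formulas with numbered variables: countability makes
  \<open>to_nat\<close> available, and numbering the sum type keeps object and parameter variables
  disjoint.\<close>

lemma definable_partitioned:
  fixes M :: "('f, 'r, 'u) struct" and X :: "'a :: countable set" and Y :: "'b :: countable set"
  assumes "finite X" "finite Y" and "definable L M (Inl ` X \<union> Inr ` Y) Q"
  obtains \<phi> and f :: "'a \<Rightarrow> nat" and g :: "'b \<Rightarrow> nat"
  where "inj f" "inj g" "partitioned_formula L \<phi> (f ` X) (g ` Y)"
    "\<And>a d. sat M (override_on d a (f ` X)) \<phi> \<longleftrightarrow> Q (case_sum (a \<circ> f) (d \<circ> g))"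
proof -
  let ?c = "to_nat :: 'a + 'b \<Rightarrow> nat"
  let ?f = "?c \<circ> Inl" and ?g = "?c \<circ> Inr"
  obtain \<phi> \<rho> where \<phi>: "wf_fm L \<phi>" "\<rho> ` fv \<phi> \<subseteq> Inl ` X \<union> Inr ` Y"
    "\<And>s. Q s \<longleftrightarrow> sat M (s \<circ> \<rho>) \<phi>"
    using assms(3) unfolding definable_def by blast
  obtain \<phi>' where \<phi>': "wf_fm L \<phi>'" "fv \<phi>' = (to_nat \<circ> \<rho>) ` fv \<phi>"
    "\<And>s. sat M s \<phi>' \<longleftrightarrow> sat M (s \<circ> (to_nat \<circ> \<rho>)) \<phi>"
    using rename_fm_exists[OF \<phi>(1)] by blast
  show thesis
  proof (rule that[of ?f ?g \<phi>'])
    show "inj ?f" "inj ?g" by (auto intro!: injI)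
    have "fv \<phi>' \<subseteq> ?f ` X \<union> ?g ` Y"
      using image_mono[OF \<phi>(2), of to_nat] by (simp add: \<phi>'(2) image_Un image_comp)
    then show "partitioned_formula L \<phi>' (?f ` X) (?g ` Y)"
      using assms \<phi>'(1) unfolding partitioned_formula_def by auto
    show "sat M (override_on d a (?f ` X)) \<phi>' \<longleftrightarrow> Q (case_sum (a \<circ> ?f) (d \<circ> ?g))" for a d
    proof -
      have "sat M (override_on d a (?f ` X)) \<phi>' \<longleftrightarrow> Q (override_on d a (?f ` X) \<circ> to_nat)"
        by (simp add: \<phi>'(3) \<phi>(3) comp_assoc)
      also have "\<dots> \<longleftrightarrow> Q (case_sum (a \<circ> ?f) (d \<circ> ?g))"
        by (rule definable_agree[OF assms(3)]) (auto simp: override_on_def)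
      finally show ?thesis .
    qed
  qed
qed

section \<open>Types in infinitely many variables\<close>

lemma definable_support_finite:
  assumes "finite F" and "\<And>Q. Q \<in> F \<Longrightarrow> definable L M V Q"
  obtains W where "finite W" "W \<subseteq> V" "\<And>Q. Q \<in> F \<Longrightarrow> definable L M W Q"
proof -
  have "\<forall>Q\<in>F. \<exists>W. finite W \<and> W \<subseteq> V \<and> definable L M W Q"
    using assms(2) definable_support by meson
  then obtain W where W: "\<forall>Q\<in>F. finite (W Q) \<and> W Q \<subseteq> V \<and> definable L M (W Q) Q"
    by metis
  show thesis
  proof (rule that[of "\<Union>Q\<in>F. W Q"])
    show "definable L M (\<Union>Q\<in>F. W Q) Q" if "Q \<in> F" for Q
      using W that by (meson UN_upper definable_mono)
  qed (use W assms(1) in auto)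
qed

text \<open>By Zorn's lemma there is a maximal partial assignment that keeps the given predicates
  finitely satisfiable. At a variable outside its domain, the existential closures of the finite
  conjunctions form a consistent 1-type over the values already chosen; a realisation of this type
  would extend the assignment.\<close>

lemma saturated_realizes_many_variables:
  fixes M :: "('f, 'r, 'u) struct" and V :: "'v set"
  assumes sat: "saturated L \<kappa> M" and V: "|V| <o \<kappa>"
    and def: "\<And>Q. Q \<in> \<Gamma> \<Longrightarrow> definable L M V Q"
    and fin: "\<And>F. finite F \<Longrightarrow> F \<subseteq> \<Gamma> \<Longrightarrow> \<exists>s\<in>V \<rightarrow> univ M. \<forall>Q\<in>F. Q s"
  shows "\<exists>s\<in>V \<rightarrow> univ M. \<forall>Q\<in>\<Gamma>. Q s"
proof -
  \<comment> \<open>Partial assignments are graphs ordered by inclusion, so that the union of a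
    chain is again a candidate. The case \<open>F = {}\<close> makes \<open>G\<close>
    functional.\<close>
  define ok where "ok G \<longleftrightarrow> G \<subseteq> V \<times> univ M \<and>
    (\<forall>F. finite F \<and> F \<subseteq> \<Gamma> \<longrightarrow>
      (\<exists>s\<in>V \<rightarrow> univ M. (\<forall>v a. (v, a) \<in> G \<longrightarrow> s v = a) \<and> (\<forall>Q\<in>F. Q s)))" for G
  have ok_extend: "\<exists>s\<in>V \<rightarrow> univ M. (\<forall>v a. (v, a) \<in> G \<longrightarrow> s v = a) \<and> (\<forall>Q\<in>F. Q s)"
    if "ok G" "finite F" "F \<subseteq> \<Gamma>" for G F
    using that unfolding ok_def by simp
  have ok_function: "\<exists>s\<in>V \<rightarrow> univ M. \<forall>v a. (v, a) \<in> G \<longrightarrow> s v = a" if "ok G" for G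
    using ok_extend[OF that, of "{}"] by simp
  have ok_functional: "a = a'" if "ok G" "(v, a) \<in> G" "(v, a') \<in> G" for G v a a'
    using ok_function[OF that(1)] that(2,3) by metis
  have "\<exists>G\<in>Collect ok. \<forall>X\<in>Collect ok. G \<subseteq> X \<longrightarrow> X = G"
  proof (rule subset_Zorn')
    fix \<G> assume chain: "subset.chain (Collect ok) \<G>"
    then have \<G>: "\<And>G. G \<in> \<G> \<Longrightarrow> ok G" and linear: "\<And>G G'. G \<in> \<G> \<Longrightarrow> G' \<in> \<G> \<Longrightarrow> G \<subseteq> G' \<or> G' \<subseteq> G"
      by (auto simp: subset_chain_def)
    show "\<Union>\<G> \<in> Collect ok"
    proof (cases "\<G> = {}")
      case True
      then show ?thesis using fin by (auto simp: ok_def)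
    next
      case False
      have functional: "a = a'" if a: "(v, a) \<in> \<Union>\<G>" "(v, a') \<in> \<Union>\<G>" for v a a'
      proof -
        obtain G where "G \<in> \<G>" "(v, a) \<in> G" "(v, a') \<in> G"
          using a linear by blast
        then show ?thesis using ok_functional \<G> by blast
      qed
      have "\<forall>v\<in>Domain (\<Union>\<G>). \<exists>a. (v, a) \<in> \<Union>\<G>"
        by blast
      then obtain u where "\<forall>v\<in>Domain (\<Union>\<G>). (v, u v) \<in> \<Union>\<G>"
        by (rule bchoice[THEN exE])
      then have u: "\<And>v. v \<in> Domain (\<Union>\<G>) \<Longrightarrow> (v, u v) \<in> \<Union>\<G>"
        by simp
      have u_eq: "u v = a" if "(v, a) \<in> \<Union>\<G>" for v a
        using functional u that by blast
      have "\<Union>\<G> \<subseteq> V \<times> univ M"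
        using \<G> by (auto simp: ok_def)
      moreover have "\<exists>s\<in>V \<rightarrow> univ M. (\<forall>v a. (v, a) \<in> \<Union>\<G> \<longrightarrow> s v = a) \<and> (\<forall>Q\<in>F. Q s)"
        if F: "finite F" "F \<subseteq> \<Gamma>" for F
      proof -
        \<comment> \<open>\<open>F\<close> sees only the finite set \<open>W\<close>, and the union
          of the chain has finitely many pairs over \<open>W\<close>, which already lie in one
          member of the chain. The solution \<open>s\<close> found for that member is then corrected
          to \<open>t\<close> without any change on \<open>W\<close>.\<close>
        obtain W where W: "finite W" "W \<subseteq> V" "\<And>Q. Q \<in> F \<Longrightarrow> definable L M W Q"
          using definable_support_finite[OF F(1), of L M V] F(2) def by blast
        let ?H = "\<Union>\<G> \<inter> W \<times> UNIV"
        have "inj_on fst ?H"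
          by (intro inj_onI) (metis IntD1 functional prod.collapse)
        moreover have "fst ` ?H \<subseteq> W"
          by auto
        ultimately have "finite ?H"
          using W(1) by (metis finite_subset inj_on_finite)
        then obtain G where G: "G \<in> \<G>" "?H \<subseteq> G"
          using finite_subset_Union_chain[OF _ _ False chain, of ?H] by blast
        obtain s where s: "s \<in> V \<rightarrow> univ M" "\<forall>v a. (v, a) \<in> G \<longrightarrow> s v = a" "\<forall>Q\<in>F. Q s"
          using ok_extend[OF \<G>[OF G(1)] F] by blast
        define t where "t v = (if v \<in> Domain (\<Union>\<G>) then u v else s v)" for v
        have "Q t" if "Q \<in> F" for Q
        proof -
          have "s v = t v" if "v \<in> W" for v
            using that u[of v] G(2) s(2) by (auto simp: t_def)
          then show ?thesis
            using definable_agree[OF W(3)[OF that], of s t] s(3) that by blast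
        qed
        moreover have "t \<in> V \<rightarrow> univ M"
        proof
          show "t v \<in> univ M" if "v \<in> V" for v
            using s(1) u[of v] \<open>\<Union>\<G> \<subseteq> V \<times> univ M\<close> that unfolding t_def
            by (metis (no_types, lifting) PiE SigmaD2 subsetD)
        qed
        moreover have "t v = a" if "(v, a) \<in> \<Union>\<G>" for v a
          using u_eq[OF that] that by (auto simp: t_def)
        ultimately show ?thesis
          by (intro bexI[of _ t]) auto
      qed
      ultimately show ?thesis by (auto simp: ok_def)
    qed
  qed
  then obtain G where okG: "ok G" and max: "\<And>X. ok X \<Longrightarrow> G \<subseteq> X \<Longrightarrow> X = G"
    by blast
  define D where "D = Domain G"
  have DV: "D \<subseteq> V"
    using okG by (auto simp: D_def ok_def)
  obtain g where g: "g \<in> V \<rightarrow> univ M" "\<And>v a. (v, a) \<in> G \<Longrightarrow> g v = a"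
    using ok_function[OF okG] by auto
  have ok_g: "\<exists>s\<in>V \<rightarrow> univ M. (\<forall>v\<in>D. s v = g v) \<and> (\<forall>Q\<in>F. Q s)" if F: "finite F" "F \<subseteq> \<Gamma>" for F
  proof -
    obtain s where s: "s \<in> V \<rightarrow> univ M" "\<forall>v a. (v, a) \<in> G \<longrightarrow> s v = a" "\<forall>Q\<in>F. Q s"
      using ok_extend[OF okG F] by blast
    moreover have "s v = g v" if "v \<in> D" for v
      using that s(2) g(2) by (auto simp: D_def)
    ultimately show ?thesis by blast
  qed
  have "D = V"
  proof (rule ccontr)
    assume "D \<noteq> V"
    then obtain v where v: "v \<in> V" "v \<notin> D"
      using DV by blast
    \<comment> \<open>The formula is to say that the values on \<open>D\<close> and at
      \<open>v\<close> extend to a solution of \<open>F\<close>; all other variables are quantified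
      away. Object variable 0 is reserved for \<open>v\<close>, and the remaining ones become
      parameters.\<close>
    define codes where "codes F \<phi> \<rho> \<longleftrightarrow>
      wf_fm L \<phi> \<and> \<rho> ` fv \<phi> \<subseteq> insert v D \<and> (\<forall>n\<in>fv \<phi>. \<rho> n = v \<longleftrightarrow> n = 0) \<and> \<rho> 0 = v \<and>
      (\<forall>s\<in>V \<rightarrow> univ M. (\<forall>Q\<in>F. Q s) \<longrightarrow> sat M (s \<circ> \<rho>) \<phi>) \<and>
      (\<forall>s\<in>V \<rightarrow> univ M. sat M (s \<circ> \<rho>) \<phi> \<longrightarrow>
        (\<exists>t\<in>V \<rightarrow> univ M. (\<forall>u\<in>insert v D. t u = s u) \<and> (\<forall>Q\<in>F. Q t)))" for F \<phi> \<rho>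
    have "\<exists>\<phi> \<rho>. codes F \<phi> \<rho>"
      if F: "finite F" "F \<subseteq> \<Gamma>" for F
    proof -
      obtain W where W: "finite W" "W \<subseteq> V" "\<And>Q. Q \<in> F \<Longrightarrow> definable L M W Q"
        using definable_support_finite[OF F(1), of L M V] F(2) def by blast
      let ?E = "W - insert v D"
      let ?R = "\<lambda>s. \<exists>a\<in>?E \<rightarrow> univ M. \<forall>Q\<in>F. Q (override_on s a ?E)"
      have "finite ?E" using W(1) by simp
      then have "definable L M (W - ?E) ?R"
        using definable_ex_set[of ?E L M W "\<lambda>s. \<forall>Q\<in>F. Q s"] definable_ball[OF F(1), of L M W "\<lambda>Q. Q"] W(3)
        by blast
      then have "definable L M (insert v D) ?R"
        by (rule definable_mono) auto
      then obtain \<phi> \<rho> where \<phi>: "wf_fm L \<phi>" "\<rho> ` fv \<phi> \<subseteq> insert v D"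
        "\<And>n. n \<in> fv \<phi> \<Longrightarrow> \<rho> n = v \<longleftrightarrow> n = 0" "\<rho> 0 = v" "\<And>s. ?R s \<longleftrightarrow> sat M (s \<circ> \<rho>) \<phi>"
        by (rule definable_isolate[where v = v]) blast
      have "sat M (s \<circ> \<rho>) \<phi>" if s: "s \<in> V \<rightarrow> univ M" "\<forall>Q\<in>F. Q s" for s
      proof -
        have "override_on s s ?E = s" by (simp add: override_on_def)
        then show ?thesis
          using s W(2) \<phi>(5)[of s] by (metis (no_types, lifting) Diff_iff Pi_iff subsetD)
      qed
      moreover have "\<exists>t\<in>V \<rightarrow> univ M. (\<forall>u\<in>insert v D. t u = s u) \<and> (\<forall>Q\<in>F. Q t)"
        if s: "s \<in> V \<rightarrow> univ M" "sat M (s \<circ> \<rho>) \<phi>" for s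
      proof -
        obtain a where "a \<in> ?E \<rightarrow> univ M" "\<forall>Q\<in>F. Q (override_on s a ?E)"
          using s(2) \<phi>(5)[of s] by blast
        then show ?thesis
          using s(1) by (intro bexI[of _ "override_on s a ?E"]) (auto simp: override_on_def Pi_iff)
      qed
      ultimately show ?thesis
        using \<phi>(1-4) unfolding codes_def by (intro exI[of _ \<phi>] exI[of _ \<rho>]) simp
    qed
    then obtain \<Phi> P where codes: "\<And>F. finite F \<Longrightarrow> F \<subseteq> \<Gamma> \<Longrightarrow> codes F (\<Phi> F) (P F)"
      by metis
    note wf = codes[unfolded codes_def, THEN conjunct1]
      and fvP = codes[unfolded codes_def, THEN conjunct2, THEN conjunct1]
      and iso = codes[unfolded codes_def, THEN conjunct2, THEN conjunct2, THEN conjunct1, THEN bspec]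
    have P0: "P F 0 = v" if "finite F" "F \<subseteq> \<Gamma>" for F
      using codes[OF that] unfolding codes_def by blast
    have \<Phi>I: "sat M (s \<circ> P F) (\<Phi> F)"
      if "finite F" "F \<subseteq> \<Gamma>" "s \<in> V \<rightarrow> univ M" "\<forall>Q\<in>F. Q s" for F s
      using codes[OF that(1,2)] that(3,4) unfolding codes_def by blast
    have \<Phi>D: "\<exists>t\<in>V \<rightarrow> univ M. (\<forall>u\<in>insert v D. t u = s u) \<and> (\<forall>Q\<in>F. Q t)"
      if "finite F" "F \<subseteq> \<Gamma>" "s \<in> V \<rightarrow> univ M" "sat M (s \<circ> P F) (\<Phi> F)" for F s
      using codes[OF that(1,2)] that(3,4) unfolding codes_def by blast
    \<comment> \<open>The 1-type of an admissible value at \<open>v\<close>: every finite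
      \<open>F\<close> contributes the condition that the new value still allows a solution of
      \<open>F\<close>, with the values of \<open>g\<close> on \<open>D\<close> as
      parameters.\<close>
    define p where "p = (\<lambda>F. (\<Phi> F, g \<circ> P F)) ` {F. finite F \<and> F \<subseteq> \<Gamma>}"
    have sat_iff: "sat M (override_on (g \<circ> P F) a {0}) (\<Phi> F) \<longleftrightarrow> sat M (s \<circ> P F) (\<Phi> F)"
      if "finite F" "F \<subseteq> \<Gamma>" "\<forall>u\<in>D. s u = g u" "s v = a 0" for F s a
      using that fvP[OF that(1,2)] iso[OF that(1,2)] P0[OF that(1,2)]
      by (intro sat_cong) (force simp: override_on_def)
    have card: "|g ` D| <o \<kappa>"
      using card_of_image[of g D] card_of_mono1[OF DV] V
      by (metis ordLeq_ordLess_trans)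
    have sub: "g ` D \<subseteq> univ M"
      using g(1) DV by (auto simp: Pi_iff)
    have over: "p \<subseteq> formulas_over L {0} (g ` D)"
      using wf fvP iso by (fastforce simp: p_def formulas_over_def)
    have cons: "consistent M {0} p"
      unfolding consistent_def
    proof (intro allI impI, elim conjE)
      fix q assume "q \<subseteq> p" "finite q"
      then obtain \<F> where \<F>: "\<F> \<subseteq> {F. finite F \<and> F \<subseteq> \<Gamma>}" "finite \<F>"
        "q = (\<lambda>F. (\<Phi> F, g \<circ> P F)) ` \<F>"
        unfolding p_def by (meson finite_subset_image)
      \<comment> \<open>Finitely many conditions are met at once by the value at \<open>v\<close> of
        one solution of the union of the sets \<open>F\<close> concerned.\<close>
      have "finite (\<Union>\<F>)" "\<Union>\<F> \<subseteq> \<Gamma>"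
        using \<F> by auto
      from ok_g[OF this] obtain s where s: "s \<in> V \<rightarrow> univ M" "\<forall>u\<in>D. s u = g u" "\<forall>Q\<in>\<Union>\<F>. Q s"
        by blast
      have "sat M (override_on (g \<circ> P F) (\<lambda>_. s v) {0}) (\<Phi> F)" if "F \<in> \<F>" for F
      proof -
        have F: "finite F" "F \<subseteq> \<Gamma>" using that \<F>(1) by auto
        have "sat M (s \<circ> P F) (\<Phi> F)"
          using s(3) that by (intro \<Phi>I[OF F s(1)]) auto
        then show ?thesis
          using sat_iff[OF F s(2), of "\<lambda>_. s v"] by simp
      qed
      then show "\<exists>a\<in>{0} \<rightarrow> univ M. realizes M {0} a q"
        using s(1) v(1) \<F>(3) by (intro bexI[of _ "\<lambda>_. s v"]) (auto simp: realizes_def Pi_iff)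
    qed
    obtain a where a: "a \<in> {0} \<rightarrow> univ M" "realizes M {0} a p"
      using sat[unfolded saturated_def, rule_format, of "g ` D" p 0] card sub over cons by auto
    have "ok (insert (v, a 0) G)"
      unfolding ok_def
    proof (intro conjI allI impI, goal_cases)
      case 1
      then show ?case using okG a(1) v(1) by (auto simp: ok_def Pi_iff)
    next
      case (2 F)
      then have F: "finite F" "F \<subseteq> \<Gamma>" by auto
      let ?s = "g(v := a 0)"
      have "sat M (override_on (g \<circ> P F) a {0}) (\<Phi> F)"
        using a(2) F by (auto simp: realizes_def p_def)
      then have "sat M (?s \<circ> P F) (\<Phi> F)"
        using sat_iff[OF F, of ?s a] v(2) by auto
      moreover have "?s \<in> V \<rightarrow> univ M"
        using g(1) a(1) by (auto simp: Pi_iff)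
      ultimately obtain t where t: "t \<in> V \<rightarrow> univ M" "\<forall>u\<in>insert v D. t u = ?s u" "\<forall>Q\<in>F. Q t"
        using \<Phi>D[OF F] by blast
      have "t u = b" if "(u, b) \<in> insert (v, a 0) G" for u b
      proof (cases "(u, b) \<in> G")
        case True
        then have "u \<in> D" "u \<noteq> v"
          using v(2) by (auto simp: D_def)
        then show ?thesis using g(2)[OF True] t(2) by simp
      next
        case False
        then show ?thesis using that t(2) by simp
      qed
      then show ?case
        using t(1,3) by blast
    qed
    then have "insert (v, a 0) G = G"
      by (rule max) blast
    then show False
      using v(2) by (auto simp: D_def)
  qed
  \<comment> \<open>Once \<open>D = V\<close>, a solution that agrees with \<open>g\<close> on
    \<open>D\<close> passes \<open>Q\<close> on to \<open>g\<close>.\<close>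
  have "Q g" if Q: "Q \<in> \<Gamma>" for Q
  proof -
    obtain s where "\<forall>v\<in>V. s v = g v" "Q s"
      using ok_g[of "{Q}"] Q \<open>D = V\<close> by auto
    then show ?thesis
      using definable_agree[OF def[OF Q], of s g] by blast
  qed
  then show ?thesis using g(1) by blast
qed

section \<open>The poset of a consistency pattern\<close>

text \<open>A closed form of the transitive closure. Each generating pair moves up one of the levels
  \<alpha>, \<beta>, \<gamma>, \<delta>, so chains have at most three steps and can be listed by the
  kinds of their end points.\<close>

definition \<Sigma>_below :: "'j set set \<Rightarrow> 'j set set \<Rightarrow> 'j point \<Rightarrow> 'j point \<Rightarrow> bool" where
  "\<Sigma>_below \<I> \<C> p q \<longleftrightarrow>
     (case p of
        \<alpha> C \<Rightarrow> C \<in> \<C> \<and>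
          (case q of
             \<alpha> D \<Rightarrow> False
           | \<beta> i \<Rightarrow> i \<in> C
           | \<gamma> j \<Rightarrow> \<exists>i\<in>C. {i, j} \<in> \<I>
           | \<delta> D \<Rightarrow> D \<in> \<C> \<and> (\<exists>i\<in>C. \<exists>j\<in>D. {i, j} \<in> \<I>))
      | \<beta> i \<Rightarrow>
          (case q of
             \<alpha> D \<Rightarrow> False
           | \<beta> j \<Rightarrow> False
           | \<gamma> j \<Rightarrow> {i, j} \<in> \<I>
           | \<delta> D \<Rightarrow> D \<in> \<C> \<and> (\<exists>j\<in>D. {i, j} \<in> \<I>))
      | \<gamma> i \<Rightarrow> (\<exists>D\<in>\<C>. q = \<delta> D \<and> i \<in> D)
      | \<delta> C \<Rightarrow> False)"

lemma \<Sigma>_less_iff: "(p, q) \<in> \<Sigma>_less \<I> \<C> \<longleftrightarrow> \<Sigma>_below \<I> \<C> p q"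
proof
  assume "(p, q) \<in> \<Sigma>_less \<I> \<C>"
  then show "\<Sigma>_below \<I> \<C> p q"
    unfolding \<Sigma>_less_def
  proof (induction rule: trancl_induct)
    case (base q)
    then show ?case by (auto simp: \<Sigma>_below_def)
  next
    case (step q r)
    then show ?case by (auto simp: \<Sigma>_below_def split: point.splits)
  qed
next
  have \<alpha>\<beta>: "(\<alpha> C, \<beta> i) \<in> \<Sigma>_less \<I> \<C>" if "C \<in> \<C>" "i \<in> C" for C i
    unfolding \<Sigma>_less_def using that by (intro r_into_trancl) auto
  have \<gamma>\<delta>: "(\<gamma> i, \<delta> C) \<in> \<Sigma>_less \<I> \<C>" if "C \<in> \<C>" "i \<in> C" for C i
    unfolding \<Sigma>_less_def using that by (intro r_into_trancl) auto
  have \<beta>\<gamma>: "(\<beta> i, \<gamma> j) \<in> \<Sigma>_less \<I> \<C>" if "{i, j} \<in> \<I>" for i j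
    unfolding \<Sigma>_less_def using that by (intro r_into_trancl) auto
  have trans: "(p, r) \<in> \<Sigma>_less \<I> \<C>" if "(p, q) \<in> \<Sigma>_less \<I> \<C>" "(q, r) \<in> \<Sigma>_less \<I> \<C>" for p q r
    using that unfolding \<Sigma>_less_def by (rule trancl_trans)
  assume "\<Sigma>_below \<I> \<C> p q"
  then show "(p, q) \<in> \<Sigma>_less \<I> \<C>"
    unfolding \<Sigma>_below_def
    by (auto split: point.splits intro: \<alpha>\<beta> \<beta>\<gamma> \<gamma>\<delta> trans[OF \<alpha>\<beta> \<beta>\<gamma>] trans[OF \<beta>\<gamma> \<gamma>\<delta>]
        trans[OF \<alpha>\<beta> trans[OF \<beta>\<gamma> \<gamma>\<delta>]])
qed

lemma partial_order_on_\<Sigma>_poset: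
  assumes "consistency_pattern J \<I> \<C>"
  shows "partial_order_on (fst (\<Sigma>_poset J \<I> \<C>)) (snd (\<Sigma>_poset J \<I> \<C>))"
proof -
  let ?A = "\<Sigma>_carrier J \<C>" and ?R = "\<Sigma>_less \<I> \<C>"
  have *: "\<And>C. C \<in> \<C> \<Longrightarrow> C \<subseteq> J" "\<And>i j. {i, j} \<in> \<I> \<Longrightarrow> i \<in> J \<and> j \<in> J"
    using assms unfolding consistency_pattern_def by auto
  have "?R \<subseteq> ?A \<times> ?A"
  proof (rule subrelI)
    fix p q assume "(p, q) \<in> ?R"
    then have "\<Sigma>_below \<I> \<C> p q" by (simp add: \<Sigma>_less_iff)
    then show "(p, q) \<in> ?A \<times> ?A"
      unfolding \<Sigma>_below_def \<Sigma>_carrier_def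
      by (auto split: point.split_asm dest: *(2) subsetD[OF *(1)])
  qed
  moreover have "trans ?R"
    unfolding \<Sigma>_less_def by (rule trans_trancl)
  \<comment> \<open>\<open>\<Sigma>_below\<close> strictly raises the level, so it never holds in
    both directions.\<close>
  moreover have "antisym ?R"
    by (rule antisymI) (auto simp: \<Sigma>_less_iff \<Sigma>_below_def split: point.split_asm)
  ultimately show ?thesis
    unfolding \<Sigma>_poset_def partial_order_on_def preorder_on_def
    by (auto simp: refl_on_def trans_def antisym_def Id_on_def)
qed

text \<open>Complementation reverses inclusion, so the sixteen kinds of pairs reduce to ten
  conditions. The order is that of the whole pattern although only \<open>J'\<close> and
  \<open>\<C>'\<close> occur: a neighbour witnessing that \<open>\<alpha> C\<close> is below
  \<open>\<gamma> j\<close> may lie outside \<open>J'\<close>.\<close>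

lemma \<Sigma>_poset_represented:
  fixes A :: "'j set \<Rightarrow> 'x \<Rightarrow> bool" and B :: "'j \<Rightarrow> 'x \<Rightarrow> bool"
  assumes pattern: "maximal_consistency_pattern J \<I> \<C>"
    and J': "J' \<subseteq> J" and \<C>': "\<C>' \<subseteq> \<C>"
    and BnB: "\<And>i j. i \<in> J' \<Longrightarrow> j \<in> J' \<Longrightarrow> (\<forall>x\<in>U. B i x \<longrightarrow> \<not> B j x) \<longleftrightarrow> {i, j} \<in> \<I>"
    and BB: "\<And>i j. i \<in> J' \<Longrightarrow> j \<in> J' \<Longrightarrow> (\<forall>x\<in>U. B i x \<longrightarrow> B j x) \<longleftrightarrow> i = j"
    and AB: "\<And>C i. C \<in> \<C>' \<Longrightarrow> i \<in> J' \<Longrightarrow> (\<forall>x\<in>U. A C x \<longrightarrow> B i x) \<longleftrightarrow> i \<in> C"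
    and AnB: "\<And>C i. C \<in> \<C>' \<Longrightarrow> i \<in> J' \<Longrightarrow> (\<forall>x\<in>U. A C x \<longrightarrow> \<not> B i x) \<longleftrightarrow> i \<notin> C"
    and AA: "\<And>C D. C \<in> \<C>' \<Longrightarrow> D \<in> \<C>' \<Longrightarrow> (\<forall>x\<in>U. A C x \<longrightarrow> A D x) \<longleftrightarrow> C = D"
    and AnA: "\<And>C D. C \<in> \<C>' \<Longrightarrow> D \<in> \<C>' \<Longrightarrow> (\<forall>x\<in>U. A C x \<longrightarrow> \<not> A D x) \<longleftrightarrow> C \<noteq> D"
    and BA: "\<And>C i. C \<in> \<C>' \<Longrightarrow> i \<in> J' \<Longrightarrow> \<exists>x\<in>U. B i x \<and> \<not> A C x"
    and nAnA: "\<And>C D. C \<in> \<C>' \<Longrightarrow> D \<in> \<C>' \<Longrightarrow> \<exists>x\<in>U. \<not> A C x \<and> \<not> A D x"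
    and nAnB: "\<And>C i. C \<in> \<C>' \<Longrightarrow> i \<in> J' \<Longrightarrow> \<exists>x\<in>U. \<not> A C x \<and> \<not> B i x"
    and nBnB: "\<And>i j. i \<in> J' \<Longrightarrow> j \<in> J' \<Longrightarrow> \<exists>x\<in>U. \<not> B i x \<and> \<not> B j x"
    and pq: "p \<in> \<Sigma>_carrier J' \<C>'" "q \<in> \<Sigma>_carrier J' \<C>'"
  defines "S \<equiv> \<lambda>p x. case p of \<alpha> C \<Rightarrow> A C x | \<beta> i \<Rightarrow> B i x | \<gamma> i \<Rightarrow> \<not> B i x | \<delta> C \<Rightarrow> \<not> A C x"
  shows "(\<forall>x\<in>U. S p x \<longrightarrow> S q x) \<longleftrightarrow> (p, q) \<in> snd (\<Sigma>_poset J \<I> \<C>)"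
proof -
  have M2: "\<And>C j. C \<in> \<C> \<Longrightarrow> j \<in> J \<Longrightarrow> j \<notin> C \<Longrightarrow> \<exists>i\<in>C. {i, j} \<in> \<I>"
    and sub: "\<And>C. C \<in> \<C> \<Longrightarrow> C \<subseteq> J"
    and indep: "\<And>C i j. C \<in> \<C> \<Longrightarrow> i \<in> C \<Longrightarrow> j \<in> C \<Longrightarrow> {i, j} \<notin> \<I>"
    using pattern unfolding maximal_consistency_pattern_def consistency_pattern_def by auto
  have \<alpha>\<gamma>: "(\<exists>i\<in>C. {i, j} \<in> \<I>) \<longleftrightarrow> j \<notin> C" if "C \<in> \<C>" "j \<in> J" for C j
    using that M2 indep by blast
  have \<beta>\<delta>: "(\<exists>i\<in>C. {j, i} \<in> \<I>) \<longleftrightarrow> j \<notin> C" if "C \<in> \<C>" "j \<in> J" for C j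
    using \<alpha>\<gamma>[OF that] by (simp add: insert_commute)
  \<comment> \<open>By \<open>M2\<close> for \<open>C\<close>, an edge between \<open>C\<close> and
    \<open>D\<close> exists iff \<open>D\<close> is not contained in \<open>C\<close>; by symmetry,
    iff \<open>C\<close> is not contained in \<open>D\<close>. Hence edges are absent exactly when
    both inclusions hold.\<close>
  have \<alpha>\<delta>: "(\<exists>i\<in>C. \<exists>j\<in>D. {i, j} \<in> \<I>) \<longleftrightarrow> C \<noteq> D" if "C \<in> \<C>" "D \<in> \<C>" for C D
  proof -
    have "(\<exists>i\<in>C. \<exists>j\<in>D. {i, j} \<in> \<I>) \<longleftrightarrow> \<not> D \<subseteq> C"
      using \<alpha>\<gamma>[OF that(1)] sub[OF that(2)] by blast
    moreover have "(\<exists>i\<in>C. \<exists>j\<in>D. {i, j} \<in> \<I>) \<longleftrightarrow> \<not> C \<subseteq> D"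
      using \<beta>\<delta>[OF that(2)] sub[OF that(1)] by blast
    ultimately show ?thesis by blast
  qed
  have flip: "(\<forall>x\<in>U. \<not> P x \<longrightarrow> \<not> Q x) \<longleftrightarrow> (\<forall>x\<in>U. Q x \<longrightarrow> P x)"
    "(\<forall>x\<in>U. P x \<longrightarrow> \<not> Q x) \<longleftrightarrow> (\<forall>x\<in>U. Q x \<longrightarrow> \<not> P x)" for P Q
    by blast+
  have "p \<in> \<Sigma>_carrier J \<C>"
    using pq(1) J' \<C>' by (auto simp: \<Sigma>_carrier_def)
  then have R: "(p, q) \<in> snd (\<Sigma>_poset J \<I> \<C>) \<longleftrightarrow> \<Sigma>_below \<I> \<C> p q \<or> p = q"
    by (auto simp: \<Sigma>_poset_def \<Sigma>_less_iff)
  have pJ: "C \<in> \<C>' \<Longrightarrow> C \<in> \<C>" "i \<in> J' \<Longrightarrow> i \<in> J" for C i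
    using J' \<C>' by auto
  note below = \<Sigma>_below_def \<alpha>\<gamma>[OF pJ(1) pJ(2)] \<beta>\<delta>[OF pJ(1) pJ(2)] \<alpha>\<delta>[OF pJ(1) pJ(1)]
  consider (a) C where "p = \<alpha> C" "C \<in> \<C>'" | (b) i where "p = \<beta> i" "i \<in> J'"
    | (c) i where "p = \<gamma> i" "i \<in> J'" | (d) C where "p = \<delta> C" "C \<in> \<C>'"
    using pq(1) by (auto simp: \<Sigma>_carrier_def)
  then show ?thesis
  proof cases
    case (a C)
    then show ?thesis
      using pq(2) unfolding R \<Sigma>_carrier_def
      by (elim UnE imageE) (simp_all add: S_def below pJ AA AB AnB AnA)
  next
    case (b i)
    have "\<not> (\<forall>x\<in>U. B i x \<longrightarrow> A D x)" if "D \<in> \<C>'" for D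
      using BA[OF that b(2)] by blast
    then show ?thesis
      using pq(2) b unfolding R \<Sigma>_carrier_def
      by (elim UnE imageE) (simp_all add: S_def below pJ BB BnB AnB flip(2)[of "B i" "A _"])
  next
    case (c i)
    have "\<not> (\<forall>x\<in>U. \<not> B i x \<longrightarrow> A D x)" if "D \<in> \<C>'" for D
      using nAnB[OF that c(2)] by blast
    moreover have "\<not> (\<forall>x\<in>U. \<not> B i x \<longrightarrow> B j x)" if "j \<in> J'" for j
      using nBnB[OF that c(2)] by blast
    ultimately show ?thesis
      using pq(2) c unfolding R \<Sigma>_carrier_def
      by (elim UnE imageE) (auto simp add: S_def below pJ flip(1) BB AB)
  next
    case (d C)
    have "\<not> (\<forall>x\<in>U. \<not> A C x \<longrightarrow> A D x)" if "D \<in> \<C>'" for D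
      using nAnA[OF that d(2)] by blast
    moreover have "\<not> (\<forall>x\<in>U. \<not> A C x \<longrightarrow> B j x)" if "j \<in> J'" for j
      using nAnB[OF d(2) that] by blast
    moreover have "\<not> (\<forall>x\<in>U. B j x \<longrightarrow> A C x)" if "j \<in> J'" for j
      using BA[OF d(2) that] by blast
    ultimately show ?thesis
      using pq(2) d unfolding R \<Sigma>_carrier_def
      by (elim UnE imageE) (auto simp add: S_def below pJ flip(1) AA)
  qed
qed

section \<open>From SOP to the tree property, and back\<close>

lemma ball_funcset_image:
  assumes "inj f"
  shows "(\<forall>a\<in>f ` X \<rightarrow> U. P (a \<circ> f)) \<longleftrightarrow> (\<forall>a\<in>X \<rightarrow> U. P a)"
proof
  assume *: "\<forall>a\<in>f ` X \<rightarrow> U. P (a \<circ> f)"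
  show "\<forall>a\<in>X \<rightarrow> U. P a"
  proof
    fix a assume "a \<in> X \<rightarrow> U"
    then have "a \<circ> inv f \<in> f ` X \<rightarrow> U"
      using assms by (auto simp: Pi_iff)
    then have "P (a \<circ> inv f \<circ> f)"
      using * by blast
    then show "P a" by (simp add: comp_assoc inv_o_cancel[OF assms])
  qed
next
  assume *: "\<forall>a\<in>X \<rightarrow> U. P a"
  show "\<forall>a\<in>f ` X \<rightarrow> U. P (a \<circ> f)"
  proof
    fix a assume "a \<in> f ` X \<rightarrow> U"
    then have "a \<circ> f \<in> X \<rightarrow> U"
      by (simp add: Pi_iff)
    with * show "P (a \<circ> f)" ..
  qed
qed

lemma bex_funcset_image:
  assumes "inj f"
  shows "(\<exists>a\<in>f ` X \<rightarrow> U. P (a \<circ> f)) \<longleftrightarrow> (\<exists>a\<in>X \<rightarrow> U. P a)"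
  using ball_funcset_image[OF assms, of X U "\<lambda>a. \<not> P a"] by blast

text \<open>A finite set of instances is the image of a finite set of indices, even if distinct
  indices share a parameter. This replaces sets of pairs by index sets in all later
  arguments.\<close>

lemma consistent_family_iff:
  "consistent M X {(\<phi>, b j) | j. j \<in> C} \<longleftrightarrow>
   (\<forall>F. finite F \<and> F \<subseteq> C \<longrightarrow> (\<exists>a\<in>X \<rightarrow> univ M. \<forall>j\<in>F. sat M (override_on (b j) a X) \<phi>))"
proof -
  let ?p = "\<lambda>F. (\<lambda>j. (\<phi>, b j)) ` F"
  have real: "realizes M X a (?p F) \<longleftrightarrow> (\<forall>j\<in>F. sat M (override_on (b j) a X) \<phi>)" for a F
    by (simp add: realizes_def)
  have "{(\<phi>, b j) | j. j \<in> C} = ?p C"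
    by blast
  moreover have "(\<forall>q. q \<subseteq> ?p C \<and> finite q \<longrightarrow> (\<exists>a\<in>X \<rightarrow> univ M. realizes M X a q)) \<longleftrightarrow>
    (\<forall>F. finite F \<and> F \<subseteq> C \<longrightarrow> (\<exists>a\<in>X \<rightarrow> univ M. realizes M X a (?p F)))" (is "?l \<longleftrightarrow> ?r")
  proof
    assume ?l
    then show ?r by (simp add: image_mono)
  next
    assume ?r
    show ?l
    proof (intro allI impI, elim conjE)
      fix q assume "q \<subseteq> ?p C" "finite q"
      then obtain F where "F \<subseteq> C" "finite F" "q = ?p F"
        by (meson finite_subset_image)
      with \<open>?r\<close> show "\<exists>a\<in>X \<rightarrow> univ M. realizes M X a q" by simp
    qed
  qed
  ultimately show ?thesis
    unfolding consistent_def real by simp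
qed

text \<open>Lets the formula be built in convenient variable types; numbering the variables
  afterwards carries the parameters along \<open>inv g\<close>. Since \<open>I\<close> is finite,
  the failure of a common realisation is already inconsistency.\<close>

lemma has_tree_propertyI:
  fixes M :: "('f, 'r, 'u) struct" and X :: "'a :: countable set" and Y :: "'b :: countable set"
    and b :: "'j \<Rightarrow> 'b \<Rightarrow> 'u"
  assumes "finite X" "finite Y" and def: "definable L M (Inl ` X \<union> Inr ` Y) Q"
    and b: "\<And>j. j \<in> J \<Longrightarrow> b j \<in> Y \<rightarrow> univ M"
    and \<C>: "\<And>C F. C \<in> \<C> \<Longrightarrow> finite F \<Longrightarrow> F \<subseteq> C \<Longrightarrow> \<exists>a\<in>X \<rightarrow> univ M. \<forall>j\<in>F. Q (case_sum a (b j))"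
    and \<I>: "\<And>I. I \<in> \<I> \<Longrightarrow> finite I \<and> \<not> (\<exists>a\<in>X \<rightarrow> univ M. \<forall>j\<in>I. Q (case_sum a (b j)))"
  shows "has_tree_property L M J \<I> \<C>"
proof -
  obtain \<phi> and f :: "'a \<Rightarrow> nat" and g :: "'b \<Rightarrow> nat" where
    inj: "inj f" "inj g" and part: "partitioned_formula L \<phi> (f ` X) (g ` Y)" and
    \<phi>: "\<And>a d. sat M (override_on d a (f ` X)) \<phi> \<longleftrightarrow> Q (case_sum (a \<circ> f) (d \<circ> g))"
    using definable_partitioned[OF assms(1-3)] by metis
  define b' where "b' j = b j \<circ> inv g" for j
  have b'g: "b' j \<circ> g = b j" for j
    by (simp add: b'_def comp_assoc inv_o_cancel[OF inj(2)])
  have cons: "consistent M (f ` X) {(\<phi>, b' j) | j. j \<in> C} \<longleftrightarrow>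
    (\<forall>F. finite F \<and> F \<subseteq> C \<longrightarrow> (\<exists>a\<in>X \<rightarrow> univ M. \<forall>j\<in>F. Q (case_sum a (b j))))" for C
    unfolding consistent_family_iff \<phi> b'g
    using bex_funcset_image[OF inj(1), where P = "\<lambda>a. \<forall>j\<in>_. Q (case_sum a (b j))"] by simp
  have "formula_has_tree_property M J \<I> \<C> \<phi> (f ` X) (g ` Y)"
    unfolding formula_has_tree_property_def cons
  proof (intro exI[of _ b'] conjI ballI)
    show "b' j \<in> g ` Y \<rightarrow> univ M" if "j \<in> J" for j
      using b[OF that] inj(2) by (auto simp: b'_def Pi_iff)
    show "consistent M (f ` X) {(\<phi>, b' j) | j. j \<in> C}" if "C \<in> \<C>" for C
      unfolding cons using \<C>[OF that] by blast
    show "\<not> consistent M (f ` X) {(\<phi>, b' j) | j. j \<in> I}" if "I \<in> \<I>" for I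
      unfolding cons using \<I>[OF that] by blast
  qed
  then show ?thesis
    unfolding has_tree_property_def using part by blast
qed

text \<open>Finite subsets of \<open>A\<close> suffice, as a member of the age borrows the
  parameters of its image under the embedding \<open>e\<close>.\<close>

lemma has_SOP_ageI:
  fixes M :: "('f, 'r, 'u) struct" and X :: "'a :: countable set" and Y :: "'b :: countable set"
  assumes "finite X" "finite Y" and def: "definable L M (Inl ` X \<union> Inr ` Y) Q"
    and SOP: "\<And>P. finite P \<Longrightarrow> P \<subseteq> A \<Longrightarrow> \<exists>d. (\<forall>p\<in>P. d p \<in> Y \<rightarrow> univ M) \<and>
      (\<forall>p\<in>P. \<forall>q\<in>P. (\<forall>a\<in>X \<rightarrow> univ M. Q (case_sum a (d p)) \<longrightarrow> Q (case_sum a (d q))) \<longleftrightarrow> (p, q) \<in> R)"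
  shows "has_SOP L M (age (A, R))"
proof -
  obtain \<phi> and f :: "'a \<Rightarrow> nat" and g :: "'b \<Rightarrow> nat" where
    inj: "inj f" "inj g" and part: "partitioned_formula L \<phi> (f ` X) (g ` Y)" and
    \<phi>: "\<And>a d. sat M (override_on d a (f ` X)) \<phi> \<longleftrightarrow> Q (case_sum (a \<circ> f) (d \<circ> g))"
    using definable_partitioned[OF assms(1-3)] by metis
  have "\<exists>d. (\<forall>s\<in>S. d s \<in> g ` Y \<rightarrow> univ M) \<and>
      (\<forall>s\<in>S. \<forall>t\<in>S. (\<forall>a\<in>f ` X \<rightarrow> univ M. sat M (override_on (d s) a (f ` X)) \<phi> \<longrightarrow>
        sat M (override_on (d t) a (f ` X)) \<phi>) \<longleftrightarrow> (s, t) \<in> R')"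
    if "(S, R') \<in> age (A, R)" for S R'
  proof -
    obtain e where e: "finite S" "e ` S \<subseteq> A" "\<And>s t. s \<in> S \<Longrightarrow> t \<in> S \<Longrightarrow> (s, t) \<in> R' \<longleftrightarrow> (e s, e t) \<in> R"
      using \<open>(S, R') \<in> age (A, R)\<close> by (force simp: age_def Pi_iff)
    obtain d where d: "\<forall>p\<in>e ` S. d p \<in> Y \<rightarrow> univ M"
      "\<forall>p\<in>e ` S. \<forall>q\<in>e ` S.
        (\<forall>a\<in>X \<rightarrow> univ M. Q (case_sum a (d p)) \<longrightarrow> Q (case_sum a (d q))) \<longleftrightarrow> (p, q) \<in> R"
      using SOP[OF finite_imageI[OF e(1)] e(2)] by blast
    define d' where "d' s = d (e s) \<circ> inv g" for s
    have d'g: "d' s \<circ> g = d (e s)" for s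
      by (simp add: d'_def comp_assoc inv_o_cancel[OF inj(2)])
    show ?thesis
    proof (intro exI[of _ d'] conjI ballI)
      show "d' s \<in> g ` Y \<rightarrow> univ M" if "s \<in> S" for s
        using d(1) that inj(2) by (auto simp: d'_def Pi_iff)
      show "(\<forall>a\<in>f ` X \<rightarrow> univ M. sat M (override_on (d' s) a (f ` X)) \<phi> \<longrightarrow>
        sat M (override_on (d' t) a (f ` X)) \<phi>) \<longleftrightarrow> (s, t) \<in> R'" if "s \<in> S" "t \<in> S" for s t
        unfolding \<phi> d'g
        using ball_funcset_image[OF inj(1),
            where P = "\<lambda>a. Q (case_sum a (d (e s))) \<longrightarrow> Q (case_sum a (d (e t)))"]
          d(2) e(3) that by simp
    qed
  qed
  then have "formula_has_SOP M (age (A, R)) \<phi> (f ` X) (g ` Y)"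
    unfolding formula_has_SOP_def by blast
  then show ?thesis
    unfolding has_SOP_def using part by blast
qed

section \<open>From SOP to the tree property\<close>

definition formula_implies ::
  "('f, 'r, 'u) struct \<Rightarrow> nat set \<Rightarrow> ('f, 'r) fm \<Rightarrow> (nat \<Rightarrow> 'u) \<Rightarrow> (nat \<Rightarrow> 'u) \<Rightarrow> bool" where
  "formula_implies M X \<psi> d e \<longleftrightarrow>
     (\<forall>a\<in>X \<rightarrow> univ M. sat M (override_on d a X) \<psi> \<longrightarrow> sat M (override_on e a X) \<psi>)"

lemma formula_implies_trans: "formula_implies M X \<psi> c d \<Longrightarrow> formula_implies M X \<psi> d e \<Longrightarrow> formula_implies M X \<psi> c e"
  unfolding formula_implies_def by blast

text \<open>Members of an age have natural numbers as points. Therefore \<open>P\<close> is counted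
  by \<open>h\<close>, its order is pulled back, and the parameters obtained are transported along
  the inverse of \<open>h\<close>.\<close>

lemma formula_has_SOP_ageD:
  assumes "formula_has_SOP M (age (A, R)) \<psi> X Y" and po: "partial_order_on A R"
    and P: "finite P" "P \<subseteq> A"
  shows "\<exists>d. (\<forall>p\<in>P. d p \<in> Y \<rightarrow> univ M) \<and> (\<forall>p\<in>P. \<forall>q\<in>P. formula_implies M X \<psi> (d p) (d q) \<longleftrightarrow> (p, q) \<in> R)"
proof -
  obtain h where h: "bij_betw h {0..<card P} P"
    using ex_bij_betw_nat_finite[OF P(1)] by blast
  let ?S = "{0..<card P}"
  let ?R = "{(s, t). s \<in> ?S \<and> t \<in> ?S \<and> (h s, h t) \<in> R}"
  have inj: "inj_on h ?S" and img: "h ` ?S = P"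
    using h by (auto simp: bij_betw_def)
  have hA: "h s \<in> A" if "s \<in> ?S" for s
    using img P(2) that by blast
  have "refl_on A R" "trans R" "antisym R"
    using po by (auto simp: partial_order_on_def preorder_on_def)
  have "refl_on ?S ?R"
    using hA \<open>refl_on A R\<close> by (auto simp: refl_on_def)
  moreover have "trans ?R"
    using \<open>trans R\<close> unfolding trans_def by blast
  moreover have "antisym ?R"
    using \<open>antisym R\<close> inj unfolding antisym_def inj_on_def by blast
  ultimately have "partial_order_on ?S ?R"
    by (auto simp: partial_order_on_def preorder_on_def)
  then have "(?S, ?R) \<in> age (A, R)"
    using hA inj unfolding age_def by (auto intro!: bexI[of _ h])
  from bspec[OF assms(1)[unfolded formula_has_SOP_def formula_implies_def[symmetric]] this]
  obtain d where d: "\<forall>s\<in>?S. d s \<in> Y \<rightarrow> univ M"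
    "\<forall>s\<in>?S. \<forall>t\<in>?S. formula_implies M X \<psi> (d s) (d t) \<longleftrightarrow> (s, t) \<in> ?R"
    unfolding prod.case by blast
  let ?k = "inv_into ?S h"
  have k: "?k p \<in> ?S" "h (?k p) = p" if "p \<in> P" for p
    using that img by (auto simp: inv_into_into f_inv_into_f simp del: atLeastLessThan_iff)
  show ?thesis
    by (rule exI[of _ "d \<circ> ?k"]) (use d k in \<open>auto simp del: atLeastLessThan_iff\<close>)
qed

text \<open>The parameters of the two instances are read off the assignment through \<open>c\<close>
  and \<open>c'\<close>. This turns parameter variables of \<open>\<psi>\<close> into free
  variables, both object and parameter, of a new formula.\<close>

lemma definable_formula_implies:
  fixes M :: "('f, 'r, 'u) struct" and c c' :: "nat \<Rightarrow> 'v"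
  assumes "wf_fm L \<psi>" "finite X" "fv \<psi> \<subseteq> X \<union> Y" and c: "c ` Y \<subseteq> V" "c' ` Y \<subseteq> V"
  shows "definable L M V (\<lambda>s. formula_implies M X \<psi> (s \<circ> c) (s \<circ> c'))"
proof -
  define h where "h c n = (if n \<in> X then Inl n else Inr (c n))" for c :: "nat \<Rightarrow> 'v" and n
  have "definable L M (Inl ` X \<union> Inr ` V) (\<lambda>t. sat M (t \<circ> h c) \<psi>)" if "c ` Y \<subseteq> V" for c
    using that assms(1,3) by (intro definable_sat) (auto simp: h_def)
  then have "definable L M (Inl ` X \<union> Inr ` V) (\<lambda>t. sat M (t \<circ> h c) \<psi> \<and> \<not> sat M (t \<circ> h c') \<psi>)"
    using c by (intro definable_conj definable_not)
  from definable_not[OF definable_ex_tuple[OF assms(2) this]]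
  have "definable L M V (\<lambda>s. \<not> (\<exists>a\<in>X \<rightarrow> univ M.
    sat M (case_sum a s \<circ> h c) \<psi> \<and> \<not> sat M (case_sum a s \<circ> h c') \<psi>))" .
  moreover have "case_sum a s \<circ> h c = override_on (s \<circ> c) a X" for a :: "nat \<Rightarrow> 'u" and s c
    by (auto simp: h_def override_on_def)
  ultimately show ?thesis
    by (simp add: formula_implies_def)
qed

text \<open>Bounds the number of variables of a type that has finitely many for each
  \<open>j \<in> J\<close>.\<close>

lemma card_of_Times_finite_ordLess:
  assumes \<kappa>: "Card_order \<kappa>" "infinite (Field \<kappa>)" and A: "|A| <o \<kappa>" and B: "finite B"
  shows "|A \<times> B| <o \<kappa>"
proof (cases "finite (A \<times> B)")
  case True
  then show ?thesis
    using \<kappa>(2) by (intro finite_ordLess_infinite card_of_Well_order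
        card_order_on_well_order_on[OF \<kappa>(1)]) (simp_all add: Field_card_of)
next
  case False
  with B have AB: "infinite A" "B \<noteq> {}"
    by auto
  with B have "|B| <o |A|"
    by (intro finite_ordLess_infinite card_of_Well_order) (simp_all add: Field_card_of)
  then have "|A \<times> B| =o |A|"
    using AB by (intro card_of_Times_infinite_simps(1) ordLess_imp_ordLeq)
  then show ?thesis
    using A by (rule ordIso_ordLess_trans)
qed

lemma tree_property_if_SOP:
  fixes M :: "('f, 'r, 'u) struct"
  assumes monster: "monster_model L T \<kappa> M" and J: "|J| <o \<kappa>"
    and pattern: "maximal_consistency_pattern J \<I> \<C>"
    and SOP: "has_SOP L M (age (\<Sigma>_poset J \<I> \<C>))"
  shows "has_tree_property L M J \<I> \<C>"
proof -
  let ?A = "\<Sigma>_carrier J \<C>"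
  define R where "R = snd (\<Sigma>_poset J \<I> \<C>)"
  have poset: "\<Sigma>_poset J \<I> \<C> = (?A, R)"
    by (simp add: R_def \<Sigma>_poset_def)
  have cp: "consistency_pattern J \<I> \<C>"
    using pattern by (simp add: maximal_consistency_pattern_def)
  then have CJ: "\<And>C. C \<in> \<C> \<Longrightarrow> C \<subseteq> J" and IJ: "\<And>I. I \<in> \<I> \<Longrightarrow> I \<subseteq> J \<and> card I = 2"
    and indep: "\<And>C i j. C \<in> \<C> \<Longrightarrow> i \<in> C \<Longrightarrow> j \<in> C \<Longrightarrow> {i, j} \<notin> \<I>"
    by (auto simp: consistency_pattern_def)
  have po: "partial_order_on ?A R"
    using partial_order_on_\<Sigma>_poset[OF cp] by (simp add: R_def \<Sigma>_poset_def)
  have \<alpha>\<beta>: "(\<alpha> C, \<beta> i) \<in> R" and \<alpha>\<gamma>: "(\<alpha> C, \<gamma> i) \<notin> R" if "C \<in> \<C>" "i \<in> C" for C i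
    using that indep[OF that(1) _ that(2)] by (auto simp: R_def \<Sigma>_poset_def \<Sigma>_less_iff \<Sigma>_below_def)
  have \<beta>\<gamma>: "(\<beta> i, \<gamma> j) \<in> R" if "{i, j} \<in> \<I>" for i j
    using that by (auto simp: R_def \<Sigma>_poset_def \<Sigma>_less_iff \<Sigma>_below_def)
  obtain \<psi> X Y where \<psi>: "partitioned_formula L \<psi> X Y" "formula_has_SOP M (age (?A, R)) \<psi> X Y"
    using SOP unfolding has_SOP_def poset by blast
  then have fin: "finite X" "finite Y" and wf: "wf_fm L \<psi>" and fv: "fv \<psi> \<subseteq> X \<union> Y"
    by (auto simp: partitioned_formula_def)
  let ?imp = "formula_implies M X \<psi>"
  have "infinite (univ M)"
    using monster by (simp add: monster_model_def)
  then obtain u where u: "u \<in> univ M"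
    using infinite_imp_nonempty by blast
  \<comment> \<open>A new parameter is a pair of \<open>Y\<close>-tuples: \<open>True\<close> marks
    the half from \<open>\<beta> j\<close>, \<open>False\<close> the half from
    \<open>\<gamma> j\<close>. In \<open>?V\<close> every \<open>j\<close> has its own copy. The new
    object tuple, on the left in \<open>Q\<close>, is also indexed by \<open>Y\<close>.\<close>
  let ?B = "(UNIV :: bool set) \<times> Y" and ?V = "J \<times> ((UNIV :: bool set) \<times> Y)"
  define Q where "Q t \<longleftrightarrow> ?imp (t \<circ> Inl) (t \<circ> (Inr \<circ> Pair True)) \<and>
    \<not> ?imp (t \<circ> Inl) (t \<circ> (Inr \<circ> Pair False))" for t :: "nat + bool \<times> nat \<Rightarrow> 'u"
  have defQ: "definable L M (Inl ` Y \<union> Inr ` ?B) Q"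
    unfolding Q_def
    by (intro definable_conj definable_not definable_formula_implies[OF wf fin(1) fv]) auto
  have Q_iff: "Q (case_sum a b) \<longleftrightarrow> ?imp a (b \<circ> Pair True) \<and> \<not> ?imp a (b \<circ> Pair False)" for a b
    unfolding Q_def by (simp add: comp_assoc[symmetric] case_sum_o_inj)
  \<comment> \<open>Quantifying out the realisation leaves a condition on the parameters alone, so
    the consistency and inconsistency requirements can be collected in the type
    \<open>\<Gamma>\<close>.\<close>
  define K where "K F s \<longleftrightarrow> (\<exists>a\<in>Y \<rightarrow> univ M. \<forall>j\<in>F. Q (case_sum a (s \<circ> Pair j)))"
    for F :: "'b set" and s
  have defK: "definable L M ?V (K F)" if F: "finite F" "F \<subseteq> J" for F
  proof -
    have "definable L M (Inl ` Y \<union> Inr ` ?V) (\<lambda>t. \<forall>j\<in>F. Q (t \<circ> map_sum id (Pair j)))"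
    proof (rule definable_ball[OF F(1)])
      fix j assume "j \<in> F"
      then show "definable L M (Inl ` Y \<union> Inr ` ?V) (\<lambda>t. Q (t \<circ> map_sum id (Pair j)))"
        using F(2) by (intro definable_mono[OF definable_subst[OF defQ]]) force
    qed
    from definable_ex_tuple[OF fin(2) this] show ?thesis
      unfolding K_def by (simp add: case_sum_o_map_sum)
  qed
  define \<Gamma> where "\<Gamma> = K ` {F. finite F \<and> (\<exists>C\<in>\<C>. F \<subseteq> C)} \<union> (\<lambda>I s. \<not> K I s) ` \<I>"
  have finI: "finite I" if "I \<in> \<I>" for I
    using IJ[OF that] by (metis card.infinite zero_neq_numeral)
  have "\<exists>s\<in>?V \<rightarrow> univ M. \<forall>q\<in>\<Gamma>. q s"
  proof (rule saturated_realizes_many_variables)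
    show "saturated L \<kappa> M"
      using monster by (simp add: monster_model_def)
    have \<kappa>: "Card_order \<kappa>" "|{\<phi>. wf_fm L \<phi>}| <o \<kappa>"
      using monster by (auto simp: monster_model_def)
    \<comment> \<open>The formulas \<open>Eq (Var n) (Var n)\<close> belong to every language, so
      \<open>\<kappa>\<close> exceeds an infinite cardinal.\<close>
    have "inj (\<lambda>n. Eq (Var n) (Var n) :: ('f, 'r) fm)"
      by (simp add: inj_def)
    then have "infinite (range (\<lambda>n. Eq (Var n) (Var n) :: ('f, 'r) fm))"
      by (simp add: finite_image_iff)
    moreover have "range (\<lambda>n. Eq (Var n) (Var n)) \<subseteq> {\<phi> :: ('f, 'r) fm. wf_fm L \<phi>}"
      by auto
    ultimately have "infinite {\<phi> :: ('f, 'r) fm. wf_fm L \<phi>}"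
      by (meson finite_subset)
    then have inf: "infinite (Field \<kappa>)"
      using \<kappa> by (meson card_of_Field_ordIso card_of_ordLeq_finite ordIso_iff_ordLeq ordLess_imp_ordLeq ordLeq_transitive)
    then show "|?V| <o \<kappa>"
      using card_of_Times_finite_ordLess[OF \<kappa>(1) _ J, of ?B] fin(2) by simp
    show "definable L M ?V q" if "q \<in> \<Gamma>" for q
    proof -
      from that consider F C where "q = K F" "finite F" "C \<in> \<C>" "F \<subseteq> C"
        | I where "q = (\<lambda>s. \<not> K I s)" "I \<in> \<I>"
        unfolding \<Gamma>_def by blast
      then show ?thesis
      proof cases
        case (1 F C)
        then show ?thesis using defK CJ by (meson order_trans)
      next
        case (2 I)
        then show ?thesis using definable_not[OF defK] finI IJ by simp
      qed
    qed
    fix G assume G: "finite G" "G \<subseteq> \<Gamma>"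
    have "finite (G \<inter> K ` {F. finite F \<and> (\<exists>C\<in>\<C>. F \<subseteq> C)})"
      using G(1) by simp
    from finite_subset_image[OF this Int_lower2] obtain \<F> where
      \<F>: "\<F> \<subseteq> {F. finite F \<and> (\<exists>C\<in>\<C>. F \<subseteq> C)}" "finite \<F>"
        "G \<inter> K ` {F. finite F \<and> (\<exists>C\<in>\<C>. F \<subseteq> C)} = K ` \<F>"
      by (elim exE conjE)
    have "finite (G \<inter> (\<lambda>I s. \<not> K I s) ` \<I>)"
      using G(1) by simp
    from finite_subset_image[OF this Int_lower2] obtain \<H> where
      \<H>: "\<H> \<subseteq> \<I>" "finite \<H>" "G \<inter> (\<lambda>I s. \<not> K I s) ` \<I> = (\<lambda>I s. \<not> K I s) ` \<H>"
      by (elim exE conjE)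
    have "\<forall>F\<in>\<F>. \<exists>C. C \<in> \<C> \<and> F \<subseteq> C"
      using \<F>(1) by blast
    then obtain c where c: "\<forall>F\<in>\<F>. c F \<in> \<C> \<and> F \<subseteq> c F"
      by (rule bchoice[THEN exE])
    define J' where "J' = \<Union>\<F> \<union> \<Union>\<H>"
    have "finite J'"
      using \<F>(1,2) \<H>(1,2) finI by (auto simp: J'_def)
    moreover have "J' \<subseteq> J"
      unfolding J'_def using c CJ \<H>(1) IJ by blast
    ultimately have J': "finite J'" "J' \<subseteq> J" .
    \<comment> \<open>SOP is applied to the finitely many points on which \<open>G\<close> depends,
      with one set \<open>c F\<close> from \<open>\<C>\<close> chosen for each positive condition
      \<open>K F\<close>.\<close>
    let ?P = "\<alpha> ` c ` \<F> \<union> \<beta> ` J' \<union> \<gamma> ` J'"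
    have "finite ?P" "?P \<subseteq> ?A"
      using \<F>(2) J' c by (auto simp: \<Sigma>_carrier_def)
    from formula_has_SOP_ageD[OF \<psi>(2) po this] obtain d where
      "\<forall>p\<in>?P. d p \<in> Y \<rightarrow> univ M" "\<forall>p\<in>?P. \<forall>q\<in>?P. ?imp (d p) (d q) \<longleftrightarrow> (p, q) \<in> R"
      by (elim exE conjE)
    note d = this[rule_format]
    \<comment> \<open>Outside \<open>J'\<close> the value \<open>u\<close> only keeps
      \<open>s\<close> inside the universe.\<close>
    define s where "s = (\<lambda>(j, z, y). if j \<in> J' then (if z then d (\<beta> j) y else d (\<gamma> j) y) else u)"
    have s: "s \<circ> Pair j \<circ> Pair True = d (\<beta> j)" "s \<circ> Pair j \<circ> Pair False = d (\<gamma> j)" if "j \<in> J'" for j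
      using that by (auto simp: s_def)
    show "\<exists>s\<in>?V \<rightarrow> univ M. \<forall>q\<in>G. q s"
    proof (intro bexI[of _ s] ballI)
      have "d (\<beta> j) y \<in> univ M" "d (\<gamma> j) y \<in> univ M" if "j \<in> J'" "y \<in> Y" for j y
        using d(1)[of "\<beta> j"] d(1)[of "\<gamma> j"] that by (auto simp: Pi_iff)
      then show "s \<in> ?V \<rightarrow> univ M"
        using u by (auto simp: s_def)
      have "K F s" if F: "F \<in> \<F>" for F
        unfolding K_def
      proof (intro bexI[of _ "d (\<alpha> (c F))"] ballI)
        show "d (\<alpha> (c F)) \<in> Y \<rightarrow> univ M"
          using F by (intro d(1)) auto
        fix j assume j: "j \<in> F"
        then have "j \<in> J'" and "c F \<in> \<C>" and "j \<in> c F"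
          using F c by (auto simp: J'_def)
        then have "?imp (d (\<alpha> (c F))) (d (\<beta> j))" "\<not> ?imp (d (\<alpha> (c F))) (d (\<gamma> j))"
          using F d(2)[of "\<alpha> (c F)" "\<beta> j"] d(2)[of "\<alpha> (c F)" "\<gamma> j"] \<alpha>\<beta> \<alpha>\<gamma> by auto
        then show "Q (case_sum (d (\<alpha> (c F))) (s \<circ> Pair j))"
          using s \<open>j \<in> J'\<close> by (simp add: Q_iff)
      qed
      \<comment> \<open>The instance of a common realisation \<open>a\<close> would imply the one at
        \<open>\<beta> i\<close>, hence the one at \<open>\<gamma> j\<close>, which \<open>Q\<close>
        at \<open>j\<close> forbids.\<close>
      moreover have "\<not> K I s" if I: "I \<in> \<H>" for I
      proof
        assume "K I s"
        obtain i j where ij: "I = {i, j}"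
          using IJ[of I] I \<H>(1) by (auto simp: card_2_iff)
        then have J'ij: "i \<in> J'" "j \<in> J'" and "{i, j} \<in> \<I>"
          using I \<H>(1) by (auto simp: J'_def)
        obtain a where "Q (case_sum a (s \<circ> Pair i))" "Q (case_sum a (s \<circ> Pair j))"
          using \<open>K I s\<close> ij by (auto simp: K_def)
        then have "?imp a (d (\<beta> i))" "\<not> ?imp a (d (\<gamma> j))"
          using s J'ij by (simp_all add: Q_iff)
        moreover have "?imp (d (\<beta> i)) (d (\<gamma> j))"
          using d(2)[of "\<beta> i" "\<gamma> j"] \<beta>\<gamma>[OF \<open>{i, j} \<in> \<I>\<close>] J'ij by auto
        ultimately show False
          using formula_implies_trans by blast
      qed
      moreover fix q assume "q \<in> G"
      then have "q \<in> K ` \<F> \<or> q \<in> (\<lambda>I s. \<not> K I s) ` \<H>"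
        using G(2) unfolding \<F>(3)[symmetric] \<H>(3)[symmetric] \<Gamma>_def by blast
      ultimately show "q s" by auto
    qed
  qed
  then obtain s where s: "s \<in> ?V \<rightarrow> univ M" "\<forall>q\<in>\<Gamma>. q s"
    by blast
  show ?thesis
  proof (rule has_tree_propertyI[OF fin(2) _ defQ, where b = "\<lambda>j. s \<circ> Pair j"])
    show "finite ?B" using fin(2) by simp
    show "s \<circ> Pair j \<in> ?B \<rightarrow> univ M" if "j \<in> J" for j
      using s(1) that by (auto simp: Pi_iff)
    show "\<exists>a\<in>Y \<rightarrow> univ M. \<forall>j\<in>F. Q (case_sum a (s \<circ> Pair j))"
      if "C \<in> \<C>" "finite F" "F \<subseteq> C" for C F
    proof -
      have "K F \<in> \<Gamma>" using that by (auto simp: \<Gamma>_def)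
      then show ?thesis using s(2) by (auto simp: K_def)
    qed
    show "finite I \<and> \<not> (\<exists>a\<in>Y \<rightarrow> univ M. \<forall>j\<in>I. Q (case_sum a (s \<circ> Pair j)))" if "I \<in> \<I>" for I
    proof -
      have "(\<lambda>s. \<not> K I s) \<in> \<Gamma>" using that by (auto simp: \<Gamma>_def)
      from bspec[OF s(2) this] show ?thesis using finI[OF that] by (simp add: K_def)
    qed
  qed
qed

section \<open>From the tree property to SOP\<close>

text \<open>Object tuples are \<open>(x, z\<^sub>1, z\<^sub>2)\<close> and parameter tuples are \<open>(y, x', w, k\<^sub>0, k\<^sub>1, k\<^sub>2)\<close>. The points
  with \<open>z\<^sub>1 = z\<^sub>2\<close> carry \<open>\<phi>(x; y)\<close>, those with \<open>z\<^sub>1 = w \<noteq> z\<^sub>2\<close> belong to the parameter \<open>w\<close> alone. The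
  equalities \<open>k\<^sub>1 = k\<^sub>0\<close> and \<open>k\<^sub>2 = k\<^sub>0\<close> encode which of \<open>\<alpha>\<close>, \<open>\<beta>\<close>, \<open>\<gamma>\<close>, \<open>\<delta>\<close> is meant.\<close>

datatype object_var = Xv nat | Z1 | Z2

instance object_var :: countable
  by countable_datatype

datatype parameter_var = Yv nat | Xc nat | W | K0 | K1 | K2

instance parameter_var :: countable
  by countable_datatype

text \<open>Only finite subposets have to be represented, so finitely many instances are met at a
  time and their realisations lie in \<open>M\<close> by finite satisfiability. The infinite
  universe provides the distinct markers.\<close>

lemma SOP_if_tree_property:
  fixes M :: "('f, 'r, 'u) struct" and J :: "'j set"
  assumes inf: "infinite (univ M)"
    and pattern: "maximal_consistency_pattern J \<I> \<C>"
    and tree: "has_tree_property L M J \<I> \<C>"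
  shows "has_SOP L M (age (\<Sigma>_poset J \<I> \<C>))"
proof -
  obtain \<phi> X Y b where \<phi>: "partitioned_formula L \<phi> X Y"
    and "\<forall>j\<in>J. b j \<in> Y \<rightarrow> univ M" "\<forall>C\<in>\<C>. consistent M X {(\<phi>, b j) | j. j \<in> C}"
      "\<forall>I\<in>\<I>. \<not> consistent M X {(\<phi>, b j) | j. j \<in> I}"
    using tree unfolding has_tree_property_def formula_has_tree_property_def by (elim exE conjE)
  note b = this(2)[rule_format] and \<C> = this(3)[rule_format] and \<I> = this(4)[rule_format]
  from \<phi> have fin: "finite X" "finite Y" and wf: "wf_fm L \<phi>" and fv: "fv \<phi> \<subseteq> X \<union> Y"
    by (auto simp: partitioned_formula_def)
  define holds where "holds x j \<longleftrightarrow> sat M (override_on (b j) x X) \<phi>" for x j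
  have real: "\<exists>x\<in>X \<rightarrow> univ M. \<forall>j\<in>F. holds x j" if "C \<in> \<C>" "finite F" "F \<subseteq> C" for C F
    using \<C>[OF that(1)] that(2,3) unfolding consistent_family_iff holds_def by simp
  have disj: "\<not> (holds x i \<and> holds x j)" if "{i, j} \<in> \<I>" "x \<in> X \<rightarrow> univ M" for i j x
  proof
    assume "holds x i \<and> holds x j"
    then have "\<forall>k\<in>F. holds x k" if "F \<subseteq> {i, j}" for F
      using that by auto
    with that(2) have "consistent M X {(\<phi>, b k) | k. k \<in> {i, j}}"
      unfolding consistent_family_iff holds_def[symmetric] by blast
    with \<I>[OF that(1)] show False by simp
  qed
  have M1: "\<exists>C\<in>\<C>. {i, j} \<subseteq> C" if "i \<in> J" "j \<in> J" "i \<noteq> j" "{i, j} \<notin> \<I>" for i j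
    using pattern[unfolded maximal_consistency_pattern_def, THEN conjunct2, THEN conjunct1,
        rule_format, of "{i, j}"] that by simp
  have M2: "\<And>C j. C \<in> \<C> \<Longrightarrow> j \<in> J \<Longrightarrow> j \<notin> C \<Longrightarrow> \<exists>i\<in>C. {i, j} \<in> \<I>"
    and CJ: "\<And>C. C \<in> \<C> \<Longrightarrow> C \<subseteq> J"
    and I2: "\<And>I. I \<in> \<I> \<Longrightarrow> card I = 2"
    using pattern unfolding maximal_consistency_pattern_def consistency_pattern_def by auto
  let ?X = "Xv ` X \<union> {Z1, Z2}" and ?Y = "Yv ` Y \<union> Xc ` X \<union> {W, K0, K1, K2}"
  let ?V = "Inl ` ?X \<union> Inr ` ?Y :: (object_var + parameter_var) set"
  define h where "h n = (if n \<in> X then Inl (Xv n) else Inr (Yv n))" for n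
  \<comment> \<open>\<open>K2 = K0\<close> selects the predicate of a single point, its failure the
    one of \<open>\<phi>\<close> with the extra points. \<open>K1 = K0\<close> is the sign: equating
    its truth value with that of the predicate yields the complement when it fails.\<close>
  define Q where "Q s \<longleftrightarrow> (s (Inr K1) = s (Inr K0) \<longleftrightarrow>
    (if s (Inr K2) = s (Inr K0) then s (Inl Z1) = s (Inl Z2) \<and> (\<forall>n\<in>X. s (Inl (Xv n)) = s (Inr (Xc n)))
     else if s (Inl Z1) = s (Inl Z2) then sat M (s \<circ> h) \<phi>
     else s (Inl Z1) = s (Inr W)))" for s :: "object_var + parameter_var \<Rightarrow> 'u"
  have "h ` fv \<phi> \<subseteq> ?V"
    using fv by (auto simp: h_def)
  then have defQ: "definable L M ?V Q"
    unfolding Q_def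
    by (intro definable_iff definable_if definable_conj definable_ball[OF fin(1)] definable_eq
        definable_sat[OF wf]) auto
  have "has_SOP L M (age (\<Sigma>_carrier J \<C>, snd (\<Sigma>_poset J \<I> \<C>)))"
  proof (rule has_SOP_ageI[OF _ _ defQ])
    show "finite ?X" "finite ?Y"
      using fin by auto
    fix P :: "'j point set"
    assume P: "finite P" "P \<subseteq> \<Sigma>_carrier J \<C>"
    define \<C>' where "\<C>' = {C. \<alpha> C \<in> P \<or> \<delta> C \<in> P}"
    have "\<C>' = \<alpha> -` P \<union> \<delta> -` P"
      by (auto simp: \<C>'_def)
    then have "finite \<C>'"
      using P(1) by (simp add: finite_vimageI inj_def)
    have "\<C>' \<subseteq> \<C>"
      using P(2) by (auto simp: \<C>'_def \<Sigma>_carrier_def)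
    \<comment> \<open>A witness of every non-inclusion within \<open>\<C>'\<close> is added to
      \<open>J'\<close>, so that points chosen for different sets \<open>C\<close> differ.\<close>
    define sep where "sep C D = (SOME j. j \<in> C - D)" for C D :: "'j set"
    have sep: "sep C D \<in> C - D" if "\<not> C \<subseteq> D" for C D
    proof -
      have "\<exists>j. j \<in> C - D" using that by blast
      from someI_ex[OF this] show ?thesis by (simp add: sep_def)
    qed
    define J0 where "J0 = {j. \<beta> j \<in> P \<or> \<gamma> j \<in> P}"
    define J' where "J' = J0 \<union> {sep C D | C D. C \<in> \<C>' \<and> D \<in> \<C>' \<and> \<not> C \<subseteq> D}"
    have "J0 = \<beta> -` P \<union> \<gamma> -` P"
      by (auto simp: J0_def)
    then have "finite J0"
      using P(1) by (simp add: finite_vimageI inj_def)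
    moreover have "{sep C D | C D. C \<in> \<C>' \<and> D \<in> \<C>' \<and> \<not> C \<subseteq> D} \<subseteq> case_prod sep ` (\<C>' \<times> \<C>')"
      by auto
    ultimately have "finite J'"
      unfolding J'_def using \<open>finite \<C>'\<close> by (meson finite_SigmaI finite_Un finite_imageI finite_subset)
    have "J' \<subseteq> J"
    proof
      fix j assume "j \<in> J'"
      then consider "j \<in> J0" | C D where "j = sep C D" "C \<in> \<C>'" "\<not> C \<subseteq> D"
        by (auto simp: J'_def)
      then show "j \<in> J"
      proof cases
        case 1
        then show ?thesis using P(2) by (auto simp: J0_def \<Sigma>_carrier_def)
      next
        case (2 C D)
        then show ?thesis using sep[OF 2(3)] CJ[of C] \<open>\<C>' \<subseteq> \<C>\<close> by auto
      qed
    qed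
    have "P \<subseteq> \<Sigma>_carrier J' \<C>'"
    proof
      fix p assume "p \<in> P"
      then show "p \<in> \<Sigma>_carrier J' \<C>'"
        by (cases p) (auto simp: \<Sigma>_carrier_def J'_def J0_def \<C>'_def)
    qed
    \<comment> \<open>By \<open>M2\<close> an index \<open>j\<close> outside \<open>C\<close> has a
      neighbour in \<open>C\<close>. Realising the neighbour's instance along with those in
      \<open>C\<close> makes the instance at \<open>j\<close> fail, so \<open>pt C\<close> satisfies
      exactly the instances wanted on \<open>J'\<close>.\<close>
    define nbr where "nbr C j = (SOME i. i \<in> C \<and> {i, j} \<in> \<I>)" for C j
    have nbr: "nbr C j \<in> C" "{nbr C j, j} \<in> \<I>" if "C \<in> \<C>'" "j \<in> J'" "j \<notin> C" for C j
    proof -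
      have "\<exists>i. i \<in> C \<and> {i, j} \<in> \<I>"
        using M2[of C j] that \<open>\<C>' \<subseteq> \<C>\<close> \<open>J' \<subseteq> J\<close> by blast
      from someI_ex[OF this] show "nbr C j \<in> C" "{nbr C j, j} \<in> \<I>"
        by (simp_all add: nbr_def)
    qed
    have "\<exists>x. x \<in> X \<rightarrow> univ M \<and> (\<forall>j\<in>J'. holds x j \<longleftrightarrow> j \<in> C)" if C: "C \<in> \<C>'" for C
    proof -
      have "C \<in> \<C>" using C \<open>\<C>' \<subseteq> \<C>\<close> by blast
      moreover have "finite (J' \<inter> C \<union> nbr C ` (J' - C))"
        using \<open>finite J'\<close> by simp
      moreover have "J' \<inter> C \<union> nbr C ` (J' - C) \<subseteq> C"
        using nbr(1)[OF C] by auto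
      ultimately obtain x where x: "x \<in> X \<rightarrow> univ M" "\<forall>j\<in>J' \<inter> C \<union> nbr C ` (J' - C). holds x j"
        using real by meson
      have "\<not> holds x j" if "j \<in> J'" "j \<notin> C" for j
        using disj[OF nbr(2)[OF C that] x(1)] x(2) that by blast
      then show ?thesis
        using x by blast
    qed
    then obtain pt where pt: "\<And>C. C \<in> \<C>' \<Longrightarrow> pt C \<in> X \<rightarrow> univ M"
      "\<And>C j. C \<in> \<C>' \<Longrightarrow> j \<in> J' \<Longrightarrow> holds (pt C) j \<longleftrightarrow> j \<in> C"
      by metis
    have pt_inj: "C = D" if CD: "C \<in> \<C>'" "D \<in> \<C>'" "\<forall>n\<in>X. pt C n = pt D n" for C D
    proof -
      have "override_on (b j) (pt C) X = override_on (b j) (pt D) X" for j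
        using CD(3) by (auto simp: override_on_def)
      then have "j \<in> C \<longleftrightarrow> j \<in> D" if "j \<in> J'" for j
        using pt(2)[OF CD(1) that] pt(2)[OF CD(2) that] by (simp add: holds_def)
      moreover have "sep C D \<in> J'" if "\<not> C \<subseteq> D" using CD(1,2) that by (auto simp: J'_def)
      moreover have "sep D C \<in> J'" if "\<not> D \<subseteq> C" using CD(1,2) that by (auto simp: J'_def)
      ultimately show ?thesis
        using sep by (metis DiffD1 DiffD2 subset_antisym)
    qed
    \<comment> \<open>The markers \<open>w i\<close> give each index points of its own.
      \<open>w0\<close> becomes the value of \<open>K0\<close> and the filler of components that do
      not concern the given kind of point; \<open>w1\<close> is a marker belonging to no
      index.\<close>
    obtain w where w: "inj_on w J'" "w ` J' \<subseteq> univ M"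
    proof -
      obtain S where "S \<subseteq> univ M" "finite S" "card S = card J'"
        using infinite_arbitrarily_large[OF inf] by blast
      then show thesis
        using that \<open>finite J'\<close> by (metis bij_betw_def finite_same_card_bij)
    qed
    have "infinite (univ M - w ` J')"
      using inf \<open>finite J'\<close> by simp
    from infinite_imp_nonempty[OF this] obtain w0 where w0: "w0 \<in> univ M" "w0 \<notin> w ` J'"
      by blast
    have "infinite (univ M - insert w0 (w ` J'))"
      using inf \<open>finite J'\<close> by simp
    from infinite_imp_nonempty[OF this] obtain w1 where
      w1: "w1 \<in> univ M" "w1 \<noteq> w0" "w1 \<notin> w ` J'"
      by blast
    let ?U = "?X \<rightarrow> univ M"
    define A where "A C x \<longleftrightarrow> x Z1 = x Z2 \<and> (\<forall>n\<in>X. x (Xv n) = pt C n)" for C x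
    define B where "B i x \<longleftrightarrow> (if x Z1 = x Z2 then holds (x \<circ> Xv) i else x Z1 = w i)" for i x
    define d where "d p = (\<lambda>v. case v of
        Yv n \<Rightarrow> (case p of \<beta> i \<Rightarrow> b i n | \<gamma> i \<Rightarrow> b i n | _ \<Rightarrow> w0)
      | Xc n \<Rightarrow> (case p of \<alpha> C \<Rightarrow> pt C n | \<delta> C \<Rightarrow> pt C n | _ \<Rightarrow> w0)
      | W \<Rightarrow> (case p of \<beta> i \<Rightarrow> w i | \<gamma> i \<Rightarrow> w i | _ \<Rightarrow> w0)
      | K0 \<Rightarrow> w0
      | K1 \<Rightarrow> (case p of \<alpha> _ \<Rightarrow> w0 | \<beta> _ \<Rightarrow> w0 | _ \<Rightarrow> w1)
      | K2 \<Rightarrow> (case p of \<alpha> _ \<Rightarrow> w0 | \<delta> _ \<Rightarrow> w0 | _ \<Rightarrow> w1))" for p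
    have Q_iff: "Q (case_sum x (d p)) \<longleftrightarrow>
        (case p of \<alpha> C \<Rightarrow> A C x | \<beta> i \<Rightarrow> B i x | \<gamma> i \<Rightarrow> \<not> B i x | \<delta> C \<Rightarrow> \<not> A C x)" for p x
    proof -
      have "case_sum x (d (\<beta> i)) \<circ> h = override_on (b i) (x \<circ> Xv) X"
        "case_sum x (d (\<gamma> i)) \<circ> h = override_on (b i) (x \<circ> Xv) X" for i
        by (auto simp: h_def d_def override_on_def)
      then show ?thesis
        unfolding Q_def using w1(2) by (cases p) (auto simp: A_def B_def holds_def d_def)
    qed
    show "\<exists>d. (\<forall>p\<in>P. d p \<in> ?Y \<rightarrow> univ M) \<and>
      (\<forall>p\<in>P. \<forall>q\<in>P. (\<forall>a\<in>?U. Q (case_sum a (d p)) \<longrightarrow> Q (case_sum a (d q))) \<longleftrightarrow>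
        (p, q) \<in> snd (\<Sigma>_poset J \<I> \<C>))"
    proof (intro exI[of _ d] conjI ballI)
      show "d p \<in> ?Y \<rightarrow> univ M" if "p \<in> P" for p
      proof -
        have "p \<in> \<Sigma>_carrier J' \<C>'"
          using that \<open>P \<subseteq> \<Sigma>_carrier J' \<C>'\<close> by blast
        moreover have "b i n \<in> univ M" "w i \<in> univ M" if "i \<in> J'" "n \<in> Y" for i n
          using b[of i] that \<open>J' \<subseteq> J\<close> w(2) by (auto simp: Pi_iff)
        moreover have "pt C n \<in> univ M" if "C \<in> \<C>'" "n \<in> X" for C n
          using pt(1)[of C] that by (auto simp: Pi_iff)
        ultimately show ?thesis
          using w0(1) w1(1) w(2) by (auto simp: \<Sigma>_carrier_def d_def)
      qed
      fix p q assume "p \<in> P" "q \<in> P"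
      then have pq: "p \<in> \<Sigma>_carrier J' \<C>'" "q \<in> \<Sigma>_carrier J' \<C>'"
        using \<open>P \<subseteq> \<Sigma>_carrier J' \<C>'\<close> by auto
      define U where "U = ?U"
      \<comment> \<open>With \<open>Z2\<close> fixed at \<open>w0\<close>, the diagonal is the case
        \<open>z = w0\<close>, and all witnesses below have this shape.\<close>
      define pair where "pair x z = (\<lambda>v. case v of Xv n \<Rightarrow> x n | Z1 \<Rightarrow> z | Z2 \<Rightarrow> w0)"
        for x :: "nat \<Rightarrow> 'u" and z
      have pair_U: "pair x z \<in> U" if "x \<in> X \<rightarrow> univ M" "z \<in> univ M" for x z
        using that w0(1) by (auto simp: U_def pair_def Pi_iff)
      have A_pair: "A C (pair x z) \<longleftrightarrow> z = w0 \<and> (\<forall>n\<in>X. x n = pt C n)" for C x z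
        by (auto simp: A_def pair_def)
      have B_pair: "B i (pair x z) \<longleftrightarrow> (if z = w0 then holds x i else z = w i)" for i x z
        by (simp add: B_def pair_def o_def)
      have const: "(\<lambda>_. w0) \<in> X \<rightarrow> univ M"
        using w0(1) by simp
      show "(\<forall>a\<in>?U. Q (case_sum a (d p)) \<longrightarrow> Q (case_sum a (d q))) \<longleftrightarrow>
        (p, q) \<in> snd (\<Sigma>_poset J \<I> \<C>)"
        unfolding Q_iff U_def[symmetric]
      proof (rule \<Sigma>_poset_represented[OF pattern \<open>J' \<subseteq> J\<close> \<open>\<C>' \<subseteq> \<C>\<close> _ _ _ _ _ _ _ _ _ _ pq])
        \<comment> \<open>Off the diagonal, the marker \<open>w i\<close> places a point in
          \<open>B i\<close> and in no other of the sets. This separates the \<open>B i\<close> from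
          each other and from every \<open>A C\<close>.\<close>
        have own: "pair (\<lambda>_. w0) (w i) \<in> U" "w i \<noteq> w0" if "i \<in> J'" for i
          using pair_U[OF const] w(2) w0(2) that by (auto simp: image_subset_iff)
        have point: "pair (pt C) w0 \<in> U" "A C (pair (pt C) w0)" if "C \<in> \<C>'" for C
          using pair_U[OF pt(1)[OF that] w0(1)] by (simp_all add: A_pair)
        have A_unique: "C = D" if "A C x" "A D x" "C \<in> \<C>'" "D \<in> \<C>'" for C D x
          using that(1,2) by (intro pt_inj[OF that(3,4)]) (simp add: A_def)
        have A_holds: "holds (x \<circ> Xv) i \<longleftrightarrow> i \<in> C" if "A C x" "C \<in> \<C>'" "i \<in> J'" for C x i
        proof -
          have "override_on (b i) (x \<circ> Xv) X = override_on (b i) (pt C) X"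
            using that(1) by (auto simp: A_def override_on_def)
          then show ?thesis using pt(2)[OF that(2,3)] by (simp add: holds_def)
        qed
        have A_B: "B i x \<longleftrightarrow> i \<in> C" if "A C x" "C \<in> \<C>'" "i \<in> J'" for C x i
          using A_holds[OF that] that(1) by (simp add: A_def B_def)
        show "(\<forall>x\<in>U. B i x \<longrightarrow> \<not> B j x) \<longleftrightarrow> {i, j} \<in> \<I>" if ij: "i \<in> J'" "j \<in> J'" for i j
        proof
          assume *: "\<forall>x\<in>U. B i x \<longrightarrow> \<not> B j x"
          \<comment> \<open>\<open>M1\<close> speaks of distinct indices only; the point marked
            \<open>w i\<close> rules out equality, since it would lie in both sets.\<close>
          have "i \<noteq> j"
            using bspec[OF * own(1)[OF ij(1)]] own(2)[OF ij(1)] by (auto simp: B_pair)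
          show "{i, j} \<in> \<I>"
          proof (rule ccontr)
            assume "{i, j} \<notin> \<I>"
            then obtain C where "C \<in> \<C>" "{i, j} \<subseteq> C"
              using M1 ij \<open>i \<noteq> j\<close> \<open>J' \<subseteq> J\<close> by blast
            then obtain x where "x \<in> X \<rightarrow> univ M" "holds x i" "holds x j"
              using real[of C "{i, j}"] by auto
            then show False
              using bspec[OF * pair_U[OF _ w0(1)]] by (simp add: B_pair)
          qed
        next
          \<comment> \<open>On the diagonal the inconsistency of the two instances makes the sets
            disjoint, off it the distinct markers do.\<close>
          assume I: "{i, j} \<in> \<I>"
          then have "i \<noteq> j" using I2 by fastforce
          then have "w i \<noteq> w j" using w(1) ij by (auto simp: inj_on_def)
          moreover have "x \<circ> Xv \<in> X \<rightarrow> univ M" if "x \<in> U" for x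
            using that by (auto simp: U_def Pi_iff)
          ultimately show "\<forall>x\<in>U. B i x \<longrightarrow> \<not> B j x"
            using disj[OF I] by (auto simp: B_def)
        qed
        show "(\<forall>x\<in>U. B i x \<longrightarrow> B j x) \<longleftrightarrow> i = j" if "i \<in> J'" "j \<in> J'" for i j
        proof
          assume *: "\<forall>x\<in>U. B i x \<longrightarrow> B j x"
          have "w i = w j"
            using bspec[OF * own(1)[OF that(1)]] own(2)[OF that(1)] by (simp add: B_pair)
          then show "i = j" using w(1) that by (auto simp: inj_on_def)
        qed simp
        show "(\<forall>x\<in>U. A C x \<longrightarrow> B i x) \<longleftrightarrow> i \<in> C" if "C \<in> \<C>'" "i \<in> J'" for C i
          using A_B[OF _ that] point[OF that(1)] by blast
        show "(\<forall>x\<in>U. A C x \<longrightarrow> \<not> B i x) \<longleftrightarrow> i \<notin> C" if "C \<in> \<C>'" "i \<in> J'" for C i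
          using A_B[OF _ that] point[OF that(1)] by blast
        show "(\<forall>x\<in>U. A C x \<longrightarrow> A D x) \<longleftrightarrow> C = D" if "C \<in> \<C>'" "D \<in> \<C>'" for C D
          using A_unique[OF _ _ that] point[OF that(1)] by blast
        show "(\<forall>x\<in>U. A C x \<longrightarrow> \<not> A D x) \<longleftrightarrow> C \<noteq> D" if "C \<in> \<C>'" "D \<in> \<C>'" for C D
          using A_unique[OF _ _ that] point[OF that(1)] by blast
        show "\<exists>x\<in>U. B i x \<and> \<not> A C x" if "C \<in> \<C>'" "i \<in> J'" for C i
          using own[OF that(2)]
          by (intro bexI[of _ "pair (\<lambda>_. w0) (w i)"]) (auto simp: A_pair B_pair)
        \<comment> \<open>The marker \<open>w1\<close> gives one point outside all
          \<open>A C\<close> and all \<open>B i\<close>, a common witness for the last three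
          conditions.\<close>
        have *: "pair (\<lambda>_. w0) w1 \<in> U" "\<And>C. \<not> A C (pair (\<lambda>_. w0) w1)"
          "\<And>i. i \<in> J' \<Longrightarrow> \<not> B i (pair (\<lambda>_. w0) w1)"
          using pair_U[OF const w1(1)] w1(2,3) by (auto simp: A_pair B_pair)
        then show "\<exists>x\<in>U. \<not> A C x \<and> \<not> A D x" for C D
          by blast
        show "\<exists>x\<in>U. \<not> A C x \<and> \<not> B i x" if "i \<in> J'" for C i
          using * that by blast
        show "\<exists>x\<in>U. \<not> B i x \<and> \<not> B j x" if "i \<in> J'" "j \<in> J'" for i j
          using * that by blast
      qed
    qed
  qed
  then show ?thesis by (simp add: \<Sigma>_poset_def)
qed

theorem theorem3p10:
  fixes L :: "('f, 'r) language"
    and T :: "('f, 'r) fm set"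
    and \<kappa> :: "'k rel"
    and \<UU> :: "('f, 'r, 'u) struct"
    and J :: "'j set"
    and \<I> \<C> :: "'j set set"
  assumes "complete_theory L T"
    and "monster_model L T \<kappa> \<UU>"
    and "|J| <o \<kappa>"
    and "maximal_consistency_pattern J \<I> \<C>"
  shows "has_tree_property L \<UU> J \<I> \<C> \<longleftrightarrow> has_SOP L \<UU> (age (\<Sigma>_poset J \<I> \<C>))"
proof
  show "has_SOP L \<UU> (age (\<Sigma>_poset J \<I> \<C>))" if "has_tree_property L \<UU> J \<I> \<C>"
    using SOP_if_tree_property[OF _ assms(4) that] assms(2) by (simp add: monster_model_def)
  show "has_tree_property L \<UU> J \<I> \<C>" if "has_SOP L \<UU> (age (\<Sigma>_poset J \<I> \<C>))"
    using tree_property_if_SOP[OF assms(2-4) that] .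
qed

end
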